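(* Suppose that $\mathbb{E}(\|Z\|^p) < \infty$ for some $p > 2$, that $\mu := \mathbb{E} Z \neq \mathbf{0}$, and that $\sigma^2_\mu = 0$. Then, as $n\to\infty$, \[ D_n - \|\mu\| n \overset{d}{\longrightarrow} \frac{\sigma^2_{\mu_\perp}\zeta^2}{2\|\mu\|}, \] where $\zeta\sim\mathcal{N}(0,1)$. Further, if, in addition, $\mathbb{E}(\|Z\|^p) < \infty$ for some $p > 4$, then \[ \lim_{n\to\infty}\operatorname{Var} D_n = \frac{\sigma^4_{\mu_\perp}}{2\|\mu\|^2}. \]
   Context: Let $Z, Z_1, Z_2, \ldots$ be i.i.d. random variables in $\mathbb{R}^2$, and let $S_0 := \mathbf{0}$ (the origin) and $S_n := \sum_{k=1}^n Z_k$ for $n \ge 1$. Let $D_n := \operatorname{diam}\{S_0, \ldots, S_n\} = \max_{0\le i,j\le n}\|S_j - S_i\|$. Here $\|\cdot\|$ is the Euclidean norm, $\mathcal{N}(0,1)$ is the standard normal distribution, and $\overset{d}{\longrightarrow}$ denotes convergence in distribution. With $\hat\mu := \mu/\|\mu\|$, define $\sigma^2 := \mathbb{E}(\|Z-\mu\|^2)$, $\sigma^2_\mu := \mathbb{E}[((Z-\mu)\cdot\hat\mu)^2]$, $\sigma^2_{\mu_\perp} := \sigma^2-\sigma^2_\mu$, and $\sigma^4_{\mu_\perp} := (\sigma^2_{\mu_\perp})^2$. *)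

theory Defs
  imports "HOL-Probability.Probability"
begin

text \<open>The increments are \<open>X 1, X 2, \<dots>\<close>; the value \<open>X 0\<close> is never used.\<close>

definition walk :: "(nat \<Rightarrow> 'a \<Rightarrow> real^2) \<Rightarrow> nat \<Rightarrow> 'a \<Rightarrow> real^2" where
  "walk X n \<omega> = (\<Sum>k=1..n. X k \<omega>)"

definition walk_diam :: "(nat \<Rightarrow> 'a \<Rightarrow> real^2) \<Rightarrow> nat \<Rightarrow> 'a \<Rightarrow> real" where
  "walk_diam X n \<omega> = diameter ((\<lambda>j. walk X j \<omega>) ` {0..n})"

definition mean_vec :: "'a measure \<Rightarrow> ('a \<Rightarrow> real^2) \<Rightarrow> real^2" where
  "mean_vec M Z = integral\<^sup>L M Z"

definition mean_dir :: "'a measure \<Rightarrow> ('a \<Rightarrow> real^2) \<Rightarrow> real^2" where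
  "mean_dir M Z = mean_vec M Z /\<^sub>R norm (mean_vec M Z)"

text \<open>The three quantities \<open>\<sigma>\<^sup>2\<close>, \<open>\<sigma>\<^sup>2\<^sub>\<mu>\<close> and
  \<open>\<sigma>\<^sup>2\<^sub>\<mu>\<^sub>\<bottom> = \<sigma>\<^sup>2 - \<sigma>\<^sup>2\<^sub>\<mu>\<close>; each constant denotes the squared quantity.\<close>

definition var_total :: "'a measure \<Rightarrow> ('a \<Rightarrow> real^2) \<Rightarrow> real" where
  "var_total M Z = (LINT \<omega>|M. (norm (Z \<omega> - mean_vec M Z))\<^sup>2)"

definition var_par :: "'a measure \<Rightarrow> ('a \<Rightarrow> real^2) \<Rightarrow> real" where
  "var_par M Z = (LINT \<omega>|M. ((Z \<omega> - mean_vec M Z) \<bullet> mean_dir M Z)\<^sup>2)"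

definition var_perp :: "'a measure \<Rightarrow> ('a \<Rightarrow> real^2) \<Rightarrow> real" where
  "var_perp M Z = var_total M Z - var_par M Z"

end

theory Submission
  imports Defs "HOL-Real_Asymp.Real_Asymp"
begin

text \<open>Write \<open>\<mu>\<close> for the mean step, \<open>m = \<parallel>\<mu>\<parallel>\<close>, and \<open>W\<^sub>j\<close> for the component of \<open>S\<^sub>j\<close> perpendicular to
\<open>\<mu>\<close>. Since \<open>\<sigma>\<^sup>2\<^sub>\<mu> = 0\<close>, almost surely every step advances by exactly \<open>m\<close> in the direction of \<open>\<mu>\<close>, so
\<open>D\<^sub>n\<close> is the diameter of the points \<open>(m j, W\<^sub>j)\<close>, \<open>j \<le> n\<close>, of the graph of a walk \<open>W\<close> on the line with
centred steps of variance \<open>v = \<sigma>\<^sup>2\<^sub>\<mu>\<^sub>\<bottom>\<close>.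

A pair \<open>i < j\<close> of times at lag \<open>k = j - i\<close> has distance about \<open>m k + (W\<^sub>j - W\<^sub>i)\<^sup>2 / (2 m k)\<close>. Giving up
\<open>R = n - k\<close> steps of lag costs \<open>m R\<close>, and the perpendicular displacement can never contribute more than
twice the maximum of \<open>\<bar>W\<bar>\<close>, which has order \<open>n\<^sup>1\<^sup>/\<^sup>2\<close>. Hence in the optimal pair both \<open>i\<close> and \<open>n - j\<close> are
at most of order \<open>n\<^sup>1\<^sup>/\<^sup>2\<close>; over such short stretches \<open>W\<close> moves only by order \<open>n\<^sup>1\<^sup>/\<^sup>4\<close>, so replacing
\<open>W\<^sub>j - W\<^sub>i\<close> by \<open>W\<^sub>n\<close> is harmless. This shows that the remainder
\<open>D\<^sub>n - m n - W\<^sub>n\<^sup>2 / (2 m n)\<close>, called \<open>excess\<close> below, tends to zero in probability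
(\<open>truncated_excess_le\<close>, \<open>excess_tendsto_in_probability\<close>), and the central limit theorem for
\<open>W\<^sub>n / n\<^sup>1\<^sup>/\<^sup>2\<close> gives the limit law \<open>v \<zeta>\<^sup>2 / (2 m)\<close>.

For the variance the remainder has to vanish in mean square. It is at most \<open>(2 / m) A\<^sup>2 / n\<close> in absolute value,
where \<open>A\<close> is the maximum of \<open>\<bar>W\<^sub>j\<bar>\<close> over \<open>j \<le> n\<close> (\<open>abs_excess_le_running_max\<close>), so uniform
integrability of \<open>A\<^sup>4 / n\<^sup>2\<close> suffices. Doob's maximal inequality for the submartingale
\<open>max 0 (W\<^sub>j\<^sup>2 - K n)\<close> reduces this to the tail quantity \<open>E (max 0 (W\<^sub>n\<^sup>2 / n - K))\<^sup>2\<close>. Its limit is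
computed exactly: the identity
\<open>(max 0 (x\<^sup>2 - K))\<^sup>2 = x\<^sup>4 - 2 K x\<^sup>2 + K\<^sup>2 - (max 0 (K - x\<^sup>2))\<^sup>2\<close> expresses it by the second and fourth moments of
\<open>W\<^sub>n\<close>, which are explicit, and by a bounded continuous function, to which the central limit theorem
applies (\<open>truncated_square_tendsto\<close>). So \<open>D\<^sub>n\<close> has the same limiting variance as \<open>W\<^sub>n\<^sup>2 / (2 m n)\<close>, namely
\<open>(3 v\<^sup>2 - v\<^sup>2) / (4 m\<^sup>2) = v\<^sup>2 / (2 m\<^sup>2)\<close>.\<close>

section \<open>Running maxima\<close>

definition running_max :: "(nat \<Rightarrow> real) \<Rightarrow> nat \<Rightarrow> real" where
  "running_max s n = Max (s ` {0..n})"

lemma running_max_0 [simp]: "running_max s 0 = s 0"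
  by (simp add: running_max_def)

lemma running_max_Suc: "running_max s (Suc n) = max (running_max s n) (s (Suc n))"
  by (simp add: running_max_def atLeast0_atMost_Suc max.commute)

lemma running_max_ge: "j \<le> n \<Longrightarrow> s j \<le> running_max s n"
  by (auto simp: running_max_def)

lemma running_max_attained: "\<exists>j\<le>n. running_max s n = s j"
proof -
  have "running_max s n \<in> s ` {0..n}" unfolding running_max_def by (intro Max_in) auto
  then show ?thesis by auto
qed

lemma running_max_measurable [measurable (raw)]:
  "(\<And>j. j \<le> n \<Longrightarrow> (\<lambda>x. s x j) \<in> borel_measurable M) \<Longrightarrow> (\<lambda>x. running_max (s x) n) \<in> borel_measurable M"
  unfolding running_max_def by (intro borel_measurable_Max) auto

text \<open>Doob's \<open>L\<^sup>2\<close> inequality in pathwise form. For a nonnegative submartingale \<open>s\<close> the sum on the right has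
nonnegative expectation, so that taking expectations yields the usual inequality with constant \<open>4\<close>.
The induction carries out a summation by parts: the running maximum increases only at times when \<open>s\<close> attains it.\<close>

lemma running_max_sq_le:
  "(running_max s n)\<^sup>2 \<le> 4 * (s n)\<^sup>2 - 4 * (\<Sum>i<n. running_max s i * (s (Suc i) - s i))"
proof -
  have "2 * (\<Sum>i<n. running_max s i * (s (Suc i) - s i)) \<le> 2 * running_max s n * s n - (running_max s n)\<^sup>2"
  proof (induction n)
    case 0
    then show ?case by (simp add: power2_eq_square)
  next
    case (Suc n)
    define b where "b = running_max s n"
    have "2 * (\<Sum>i<Suc n. running_max s i * (s (Suc i) - s i)) \<le> 2 * b * s (Suc n) - b\<^sup>2"
      using Suc by (simp add: b_def algebra_simps)
    also have "\<dots> \<le> 2 * max b (s (Suc n)) * s (Suc n) - (max b (s (Suc n)))\<^sup>2"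
      using zero_le_power2[of "b - s (Suc n)"] by (auto simp: max_def power2_eq_square algebra_simps)
    finally show ?case by (simp add: running_max_Suc b_def)
  qed
  then show ?thesis using zero_le_power2[of "running_max s n - 2 * s n"]
    by (simp add: power2_eq_square algebra_simps)
qed

section \<open>The diameter of the graph of a real sequence\<close>

text \<open>The diameter of the planar point set \<open>{(m j, w j) | j \<le> n}\<close>, written as a finite maximum so that
measurability is immediate.\<close>

definition graph_diam :: "real \<Rightarrow> (nat \<Rightarrow> real) \<Rightarrow> nat \<Rightarrow> real" where
  "graph_diam m w n =
    Max ((\<lambda>(i, j). sqrt ((m * (real j - real i))\<^sup>2 + (w j - w i)\<^sup>2)) ` ({0..n} \<times> {0..n}))"

lemma graph_diam_measurable [measurable (raw)]:
  assumes "\<And>j. (\<lambda>x. w x j) \<in> borel_measurable M"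
  shows "(\<lambda>x. graph_diam m (w x) n) \<in> borel_measurable M"
  unfolding graph_diam_def using assms
  by (intro borel_measurable_Max) (auto simp: case_prod_beta)

lemma graph_diam_ge:
  "i \<le> n \<Longrightarrow> j \<le> n \<Longrightarrow> sqrt ((m * (real j - real i))\<^sup>2 + (w j - w i)\<^sup>2) \<le> graph_diam m w n"
  unfolding graph_diam_def by (intro Max_ge) (auto intro!: image_eqI[of _ _ "(i, j)"])

lemma graph_diam_le:
  assumes "\<And>i j. i \<le> j \<Longrightarrow> j \<le> n \<Longrightarrow> sqrt ((m * (real j - real i))\<^sup>2 + (w j - w i)\<^sup>2) \<le> c"
  shows "graph_diam m w n \<le> c"
proof -
  have "sqrt ((m * (real j - real i))\<^sup>2 + (w j - w i)\<^sup>2) \<le> c" if "i \<le> n" "j \<le> n" for i j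
  proof (cases "i \<le> j")
    case False
    then have "sqrt ((m * (real i - real j))\<^sup>2 + (w i - w j)\<^sup>2) \<le> c"
      using that assms[of j i] by simp
    moreover have "(m * (real i - real j))\<^sup>2 = (m * (real j - real i))\<^sup>2" "(w i - w j)\<^sup>2 = (w j - w i)\<^sup>2"
      by (simp_all add: power2_eq_square algebra_simps)
    ultimately show ?thesis by simp
  qed (use that assms in auto)
  then show ?thesis unfolding graph_diam_def by (intro Max.boundedI) auto
qed

lemma sqrt_add_sq_le:
  fixes a x :: real assumes "a > 0"
  shows "sqrt (a\<^sup>2 + x\<^sup>2) \<le> a + x\<^sup>2 / (2 * a)"
proof (rule real_le_lsqrt)
  have "(a + x\<^sup>2 / (2 * a))\<^sup>2 = a\<^sup>2 + x\<^sup>2 + (x\<^sup>2 / (2 * a))\<^sup>2"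
    using assms by (simp add: power2_sum)
  then show "a\<^sup>2 + x\<^sup>2 \<le> (a + x\<^sup>2 / (2 * a))\<^sup>2" by simp
qed (use assms in auto)

text \<open>With \<open>l = sqrt (a\<^sup>2 + x\<^sup>2) - a\<close> one has exactly \<open>x\<^sup>2 / (2 a) = l + l\<^sup>2 / (2 a)\<close>, so the error of the
second-order expansion is \<open>l\<^sup>2 / (2 a)\<close>, and \<open>l \<le> x\<^sup>2 / (2 a)\<close>.\<close>

lemma sqrt_add_sq_ge:
  fixes a x :: real assumes "a > 0"
  shows "a + x\<^sup>2 / (2 * a) - (x\<^sup>2 / (2 * a))\<^sup>2 / (2 * a) \<le> sqrt (a\<^sup>2 + x\<^sup>2)"
proof -
  define l where "l = sqrt (a\<^sup>2 + x\<^sup>2) - a"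
  have "l \<ge> 0" unfolding l_def using assms by (simp add: real_le_rsqrt)
  have "(l + a)\<^sup>2 = a\<^sup>2 + x\<^sup>2" unfolding l_def by simp
  then have e: "x\<^sup>2 / (2 * a) = l + l\<^sup>2 / (2 * a)"
    using assms by (simp add: power2_eq_square field_simps)
  have "l\<^sup>2 \<le> (x\<^sup>2 / (2 * a))\<^sup>2"
    using \<open>l \<ge> 0\<close> assms by (intro power_mono) (auto simp: e)
  then have "l\<^sup>2 / (2 * a) \<le> (x\<^sup>2 / (2 * a))\<^sup>2 / (2 * a)" using assms by (intro divide_right_mono) auto
  then show ?thesis using e unfolding l_def by linarith
qed

lemma graph_diam_lower:
  assumes "w 0 = 0"
  shows "sqrt ((m * real n)\<^sup>2 + (w n)\<^sup>2) \<le> graph_diam m w n"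
  using graph_diam_ge[of 0 n n m w] assms by simp

lemma abs_increment_le_running_max:
  assumes "i \<le> n" "j \<le> n"
  shows "\<bar>w j - w i\<bar> \<le> 2 * running_max (\<lambda>k. \<bar>w k\<bar>) n"
  using running_max_ge[OF assms(1), of "\<lambda>k. \<bar>w k\<bar>"] running_max_ge[OF assms(2), of "\<lambda>k. \<bar>w k\<bar>"] by linarith

text \<open>Bounding lag and displacement of every pair separately by their maxima loses a constant factor in the
second-order term, but the result holds on every path and so controls moments.\<close>

lemma graph_diam_upper_crude:
  assumes "m > 0" "n > 0"
  shows "graph_diam m w n \<le> m * n + 2 * (running_max (\<lambda>k. \<bar>w k\<bar>) n)\<^sup>2 / (m * n)"
proof (rule graph_diam_le)
  define A where "A = running_max (\<lambda>k. \<bar>w k\<bar>) n"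
  fix i j assume ij: "i \<le> j" "j \<le> n"
  have "(m * (real j - real i))\<^sup>2 \<le> (m * n)\<^sup>2"
    using assms ij by (intro power_mono mult_left_mono) auto
  moreover have "(w j - w i)\<^sup>2 \<le> (2 * A)\<^sup>2"
    using power_mono[OF abs_increment_le_running_max[of i n j w] abs_ge_zero, of 2] ij by (simp add: A_def)
  ultimately have "sqrt ((m * (real j - real i))\<^sup>2 + (w j - w i)\<^sup>2) \<le> sqrt ((m * n)\<^sup>2 + (2 * A)\<^sup>2)"
    by simp
  also have "\<dots> \<le> m * n + (2 * A)\<^sup>2 / (2 * (m * n))"
    using assms by (intro sqrt_add_sq_le) auto
  also have "(2 * A)\<^sup>2 / (2 * (m * n)) = 2 * A\<^sup>2 / (m * n)" using assms by (simp add: field_simps)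
  finally show "sqrt ((m * (real j - real i))\<^sup>2 + (w j - w i)\<^sup>2) \<le> m * n + 2 * A\<^sup>2 / (m * n)" .
qed

text \<open>If the displacement \<open>2 max \<bar>w\<bar>\<close> cannot pay for a loss of lag of \<open>\<rho>\<close>, then only pairs with
\<open>i + (n - j) \<le> \<rho>\<close> matter. For these, \<open>w j - w i\<close> differs from \<open>w n\<close> by at most the oscillation \<open>b\<close> of \<open>w\<close>
over the first and the last \<open>r\<close> steps. The last stretch is measured from its left end \<open>n - r\<close>, which makes it
the path of a walk started at time \<open>n - r\<close>; the price is the factor \<open>2\<close>.\<close>

lemma graph_diam_upper_local:
  fixes w :: "nat \<Rightarrow> real" and \<rho> m :: real and n r :: nat
  assumes m: "m > 0" and r: "r = nat \<lfloor>\<rho>\<rfloor>" and \<rho>: "0 \<le> \<rho>" "\<rho> < n"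
    and A: "2 * running_max (\<lambda>k. \<bar>w k\<bar>) n \<le> m * \<rho>"
    and b: "b = running_max (\<lambda>k. \<bar>w k\<bar>) r + 2 * running_max (\<lambda>k. \<bar>w (n - r + k) - w (n - r)\<bar>) r"
  shows "graph_diam m w n \<le> m * n + (\<bar>w n\<bar> + b)\<^sup>2 / (2 * m * (n - \<rho>))"
proof (rule graph_diam_le)
  fix i j assume ij: "i \<le> j" "j \<le> n"
  have r\<rho>: "real r \<le> \<rho>" "\<rho> < real r + 1" using \<rho> r by linarith+
  define x where "x = w j - w i"
  show "sqrt ((m * (real j - real i))\<^sup>2 + (w j - w i)\<^sup>2) \<le> m * n + (\<bar>w n\<bar> + b)\<^sup>2 / (2 * m * (n - \<rho>))"
  proof (cases "i + (n - j) \<le> r")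
    case True
    have rn: "r \<le> n" using r\<rho> \<rho> by linarith
    have k: "n - \<rho> \<le> real j - real i" "real j - real i \<le> n" using True ij r\<rho> by linarith+
    have "\<bar>w i\<bar> \<le> running_max (\<lambda>k. \<bar>w k\<bar>) r"
      using running_max_ge[of i r "\<lambda>k. \<bar>w k\<bar>"] True by simp
    moreover have "\<bar>w n - w (n - r)\<bar> \<le> running_max (\<lambda>k. \<bar>w (n - r + k) - w (n - r)\<bar>) r"
      using running_max_ge[of r r "\<lambda>k. \<bar>w (n - r + k) - w (n - r)\<bar>"] rn by simp
    moreover have "n - r + (j - (n - r)) = j" "j - (n - r) \<le> r" using True ij rn by auto
    then have "\<bar>w j - w (n - r)\<bar> \<le> running_max (\<lambda>k. \<bar>w (n - r + k) - w (n - r)\<bar>) r"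
      using running_max_ge[of "j - (n - r)" r "\<lambda>k. \<bar>w (n - r + k) - w (n - r)\<bar>"] by simp
    ultimately have "\<bar>x\<bar> \<le> \<bar>w n\<bar> + b" unfolding b x_def by linarith
    then have "x\<^sup>2 \<le> (\<bar>w n\<bar> + b)\<^sup>2" by (metis abs_ge_zero power2_abs power_mono)
    have "sqrt ((m * (real j - real i))\<^sup>2 + x\<^sup>2) \<le> m * (real j - real i) + x\<^sup>2 / (2 * (m * (real j - real i)))"
      using m k \<rho> by (intro sqrt_add_sq_le) auto
    also have "\<dots> \<le> m * n + (\<bar>w n\<bar> + b)\<^sup>2 / (2 * m * (n - \<rho>))"
      using m k \<rho> \<open>x\<^sup>2 \<le> _\<close> by (intro add_mono mult_left_mono frac_le) auto
    finally show ?thesis by (simp add: x_def)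
  next
    case False
    then have "\<rho> \<le> n - (real j - real i)" using r\<rho> ij by linarith
    then have "m * \<rho> \<le> m * (n - (real j - real i))" using m by (intro mult_left_mono) auto
    moreover have "\<bar>x\<bar> \<le> m * \<rho>" using abs_increment_le_running_max[of i n j w] ij A x_def by simp
    ultimately have "\<bar>m * (real j - real i)\<bar> + \<bar>x\<bar> \<le> m * n"
      using m ij by (simp add: algebra_simps)
    moreover have "sqrt ((m * (real j - real i))\<^sup>2 + x\<^sup>2) \<le> \<bar>m * (real j - real i)\<bar> + \<bar>x\<bar>"
      by (rule sqrt_sum_squares_le_sum_abs)
    moreover have "0 \<le> (\<bar>w n\<bar> + b)\<^sup>2 / (2 * m * (n - \<rho>))" using m \<rho> by simp
    ultimately show ?thesis unfolding x_def by linarith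
  qed
qed

text \<open>A weighted form of Young's inequality: with small \<open>d\<close> the square \<open>a\<^sup>2\<close> keeps a coefficient close to \<open>1\<close>,
and the cross term is absorbed into a large multiple of \<open>b\<^sup>2\<close>.\<close>

lemma square_sum_le_weighted:
  fixes a b d :: real assumes "d > 0"
  shows "(a + b)\<^sup>2 \<le> (1 + d) * a\<^sup>2 + (1 + 1 / d) * b\<^sup>2"
proof -
  have "0 \<le> (d * a - b)\<^sup>2 / d" using assms by simp
  also have "(d * a - b)\<^sup>2 / d = d * a\<^sup>2 - 2 * a * b + b\<^sup>2 / d"
    using assms by (simp add: power2_eq_square field_simps)
  finally show ?thesis by (simp add: power2_eq_square algebra_simps)
qed

text \<open>The subtracted terms are the second-order expansion of the distance between the two end points of the graph
when \<open>w 0 = 0\<close>.\<close>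

definition excess :: "real \<Rightarrow> (nat \<Rightarrow> real) \<Rightarrow> nat \<Rightarrow> real" where
  "excess m w n = graph_diam m w n - m * n - (w n)\<^sup>2 / (2 * m * n)"

lemma excess_measurable [measurable (raw)]:
  assumes "\<And>j. (\<lambda>x. w x j) \<in> borel_measurable M"
  shows "(\<lambda>x. excess m (w x) n) \<in> borel_measurable M"
  unfolding excess_def using assms by measurable

lemma abs_excess_le_running_max:
  assumes "m > 0" "n > 0" "w 0 = 0"
  shows "\<bar>excess m w n\<bar> \<le> 2 / m * ((running_max (\<lambda>k. \<bar>w k\<bar>) n)\<^sup>2 / n)"
proof -
  define A where "A = running_max (\<lambda>k. \<bar>w k\<bar>) n"
  have "\<bar>w n\<bar> \<le> A" unfolding A_def using running_max_ge[of n n "\<lambda>k. \<bar>w k\<bar>"] by simp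
  then have "(w n)\<^sup>2 \<le> A\<^sup>2" by (metis abs_ge_zero power2_abs power_mono)
  then have "(w n)\<^sup>2 \<le> 4 * A\<^sup>2" using zero_le_power2[of A] by linarith
  then have "(w n)\<^sup>2 / (2 * m * n) \<le> 2 * A\<^sup>2 / (m * n)"
    using assms by (simp add: field_simps)
  moreover have "0 \<le> (w n)\<^sup>2 / (2 * m * n)" using assms by simp
  moreover have "m * n \<le> graph_diam m w n"
  proof -
    have "m * n \<le> sqrt ((m * real n)\<^sup>2 + (w n)\<^sup>2)" using assms by (intro real_le_rsqrt) auto
    then show ?thesis using graph_diam_lower[of w m n, OF assms(3)] by linarith
  qed
  moreover have "graph_diam m w n \<le> m * n + 2 * A\<^sup>2 / (m * n)"
    unfolding A_def using assms by (intro graph_diam_upper_crude) auto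
  ultimately have "\<bar>excess m w n\<bar> \<le> 2 * A\<^sup>2 / (m * n)"
    unfolding excess_def by linarith
  then show ?thesis by (simp add: A_def)
qed

text \<open>The truncated remainder is bounded by quantities that are linear in squares of maxima, so that its expectation
can be estimated by the maximal inequality alone. The first term covers paths on which the
threshold \<open>\<rho>\<close> on the loss of lag is too small (it is then at least \<open>1\<close>, as in Chebyshev's inequality), the second
the paths controlled by the bound on short stretches, and the third the deviation of the end-to-end
distance below its second-order expansion.\<close>

lemma truncated_excess_le:
  fixes w :: "nat \<Rightarrow> real" and \<rho> m \<delta> :: real and n r :: nat
  assumes m: "m > 0" and r: "r = nat \<lfloor>\<rho>\<rfloor>" and \<rho>: "0 < \<rho>" "\<rho> < n" and d: "\<delta> > 0" and w0: "w 0 = 0"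
  shows "min 1 \<bar>excess m w n\<bar> \<le>
      4 / (m * \<rho>)\<^sup>2 * (running_max (\<lambda>k. \<bar>w k\<bar>) n)\<^sup>2
    + (((1 + \<delta>) * (w n)\<^sup>2 + (1 + 1 / \<delta>) * (2 * (running_max (\<lambda>k. \<bar>w k\<bar>) r)\<^sup>2
          + 8 * (running_max (\<lambda>k. \<bar>w (n - r + k) - w (n - r)\<bar>) r)\<^sup>2)) / (n - \<rho>) - (w n)\<^sup>2 / n) / (2 * m)
    + (w n)\<^sup>2 / (2 * m * n * sqrt (2 * m * n))" (is "_ \<le> ?far + ?near + ?low")
proof -
  define A B C where "A = running_max (\<lambda>k. \<bar>w k\<bar>) n" and "B = running_max (\<lambda>k. \<bar>w k\<bar>) r"
    and "C = running_max (\<lambda>k. \<bar>w (n - r + k) - w (n - r)\<bar>) r"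
  define u where "u = (w n)\<^sup>2 / (2 * m * n)"
  have u0: "u \<ge> 0" and n0: "real n > 0" using m \<rho> by (auto simp: u_def)
  have far0: "?far \<ge> 0" and low0: "?low \<ge> 0" using m n0 by auto
  have b2: "(B + 2 * C)\<^sup>2 \<le> 2 * B\<^sup>2 + 8 * C\<^sup>2"
    using zero_le_power2[of "B - 2 * C"] by (simp add: power2_eq_square algebra_simps)
  have "(\<bar>w n\<bar> + (B + 2 * C))\<^sup>2 \<le> (1 + \<delta>) * \<bar>w n\<bar>\<^sup>2 + (1 + 1 / \<delta>) * (B + 2 * C)\<^sup>2"
    by (rule square_sum_le_weighted[OF d])
  also have "\<dots> \<le> (1 + \<delta>) * (w n)\<^sup>2 + (1 + 1 / \<delta>) * (2 * B\<^sup>2 + 8 * C\<^sup>2)" (is "_ \<le> ?q")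
    using b2 d by (intro add_mono mult_left_mono) auto
  finally have q: "(\<bar>w n\<bar> + (B + 2 * C))\<^sup>2 \<le> ?q" .
  have near: "?near = ?q / (2 * m * (n - \<rho>)) - u"
    unfolding A_def B_def C_def u_def using m \<rho> n0 by (simp add: field_simps)
  have near0: "?near \<ge> 0"
  proof -
    have "(w n)\<^sup>2 / n \<le> ?q / (n - \<rho>)"
    proof (rule frac_le)
      have "0 \<le> (w n)\<^sup>2" "0 \<le> \<delta> * (w n)\<^sup>2" "0 \<le> (1 + 1 / \<delta>) * (2 * B\<^sup>2 + 8 * C\<^sup>2)" using d by auto
      then show "(w n)\<^sup>2 \<le> ?q" "0 \<le> ?q" unfolding distrib_right by linarith+
    qed (use \<rho> in auto)
    then show ?thesis using m by (simp add: A_def B_def C_def)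
  qed
  have lower: "min 1 (- excess m w n) \<le> ?low"
  proof -
    have "m * n + u - u\<^sup>2 / (2 * (m * n)) \<le> sqrt ((m * n)\<^sup>2 + (w n)\<^sup>2)"
      using sqrt_add_sq_ge[of "m * n" "w n"] m n0 by (simp add: u_def mult.assoc)
    also have "\<dots> \<le> graph_diam m w n" by (rule graph_diam_lower[of w m n, OF w0])
    finally have "- excess m w n \<le> u\<^sup>2 / (2 * m * n)" unfolding excess_def u_def by (simp add: mult.assoc)
    then have "min 1 (- excess m w n) \<le> min 1 (u\<^sup>2 / (2 * m * n))" by simp
    \<comment> \<open>The truncation at 1 permits to pass to the square root, which lowers the degree in \<open>w n\<close> from 4 to 2.\<close>
    also have "\<dots> \<le> sqrt (u\<^sup>2 / (2 * m * n))"
    proof (cases "u\<^sup>2 / (2 * m * n) \<le> 1")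
      case True
      moreover have "0 \<le> u\<^sup>2 / (2 * m * n)" using m n0 by simp
      ultimately have "(u\<^sup>2 / (2 * m * n))\<^sup>2 \<le> u\<^sup>2 / (2 * m * n)"
        unfolding power2_eq_square[of "u\<^sup>2 / (2 * m * n)"] by (intro mult_left_le)
      then have "u\<^sup>2 / (2 * m * n) \<le> sqrt (u\<^sup>2 / (2 * m * n))" by (rule real_le_rsqrt)
      then show ?thesis by simp
    next
      case False
      then have "1 \<le> sqrt (u\<^sup>2 / (2 * m * n))" by simp
      then show ?thesis by simp
    qed
    also have "\<dots> = u / sqrt (2 * m * n)" using u0 by (simp add: real_sqrt_divide)
    finally show ?thesis by (simp add: u_def)
  qed
  have upper: "min 1 (excess m w n) \<le> ?far + ?near"
  proof (cases "2 * A \<le> m * \<rho>")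
    case True
    then have "graph_diam m w n \<le> m * n + (\<bar>w n\<bar> + (B + 2 * C))\<^sup>2 / (2 * m * (n - \<rho>))"
      using m r \<rho> by (intro graph_diam_upper_local) (auto simp: A_def B_def C_def)
    also have "\<dots> \<le> m * n + ?q / (2 * m * (n - \<rho>))"
      using q m \<rho> by (intro add_left_mono divide_right_mono) auto
    finally have "excess m w n \<le> ?near" unfolding near excess_def u_def by linarith
    then show ?thesis using far0 by linarith
  next
    case False
    then have "(m * \<rho>)\<^sup>2 \<le> (2 * A)\<^sup>2" using m \<rho> by (intro power_mono) auto
    then have "1 \<le> ?far" using m \<rho> by (simp add: A_def[symmetric] field_simps)
    then show ?thesis using near0 by linarith
  qed
  show ?thesis
  proof (cases "excess m w n \<ge> 0")
    case True
    then show ?thesis using upper low0 by linarith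
  next
    case False
    then show ?thesis using lower far0 near0 by linarith
  qed
qed

section \<open>Centred random walks and their maxima\<close>

lemma integrable_mult_of_squares:
  fixes f g :: "'a \<Rightarrow> real"
  assumes [measurable]: "f \<in> borel_measurable M" "g \<in> borel_measurable M"
    and "integrable M (\<lambda>\<omega>. (f \<omega>)\<^sup>2)" "integrable M (\<lambda>\<omega>. (g \<omega>)\<^sup>2)"
  shows "integrable M (\<lambda>\<omega>. f \<omega> * g \<omega>)"
proof (rule Bochner_Integration.integrable_bound)
  show "integrable M (\<lambda>\<omega>. (f \<omega>)\<^sup>2 + (g \<omega>)\<^sup>2)" using assms by simp
  have "\<bar>a * b\<bar> \<le> a\<^sup>2 + b\<^sup>2" for a b :: real
  proof -
    have "2 * (\<bar>a\<bar> * \<bar>b\<bar>) \<le> a\<^sup>2 + b\<^sup>2" using sum_squares_bound[of "\<bar>a\<bar>" "\<bar>b\<bar>"] by simp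
    moreover have "0 \<le> \<bar>a\<bar> * \<bar>b\<bar>" by simp
    ultimately show ?thesis unfolding abs_mult by linarith
  qed
  then show "AE \<omega> in M. norm (f \<omega> * g \<omega>) \<le> norm ((f \<omega>)\<^sup>2 + (g \<omega>)\<^sup>2)" by simp
qed simp

locale centred_walk = prob_space +
  fixes Y :: "nat \<Rightarrow> 'a \<Rightarrow> real"
  assumes indep: "indep_vars (\<lambda>_. borel) Y UNIV"
    and same_distr: "distr M borel (Y k) = distr M borel (Y 0)"
    and square_integrable: "integrable M (\<lambda>\<omega>. (Y 0 \<omega>)\<^sup>2)"
    and mean_zero: "expectation (Y 0) = 0"
begin

definition step_var :: real where "step_var = expectation (\<lambda>\<omega>. (Y 0 \<omega>)\<^sup>2)"

definition W :: "nat \<Rightarrow> 'a \<Rightarrow> real" where "W n \<omega> = (\<Sum>k<n. Y k \<omega>)"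

lemma Y_measurable [measurable]: "Y k \<in> borel_measurable M"
  using indep by (simp add: indep_vars_def)

lemma W_measurable [measurable]: "W n \<in> borel_measurable M"
  unfolding W_def[abs_def] by measurable

lemma W_0 [simp]: "W 0 \<omega> = 0" and W_Suc: "W (Suc n) \<omega> = W n \<omega> + Y n \<omega>"
  by (simp_all add: W_def)

lemma integrable_step_iff:
  assumes [measurable]: "f \<in> borel_measurable borel"
  shows "integrable M (\<lambda>\<omega>. f (Y k \<omega>) :: real) \<longleftrightarrow> integrable M (\<lambda>\<omega>. f (Y 0 \<omega>))"
  using same_distr[of k] integrable_distr_eq[of "Y k" M borel f] integrable_distr_eq[of "Y 0" M borel f]
  by simp

lemma expectation_step:
  assumes [measurable]: "f \<in> borel_measurable borel"
  shows "expectation (\<lambda>\<omega>. f (Y k \<omega>) :: real) = expectation (\<lambda>\<omega>. f (Y 0 \<omega>))"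
  using same_distr[of k] integral_distr[of "Y k" M borel f] integral_distr[of "Y 0" M borel f]
  by simp

lemma step_var_nonneg: "step_var \<ge> 0"
  by (simp add: step_var_def)

lemma Y_square_integrable: "integrable M (\<lambda>\<omega>. (Y k \<omega>)\<^sup>2)"
  using integrable_step_iff[of "\<lambda>y. y\<^sup>2" k] square_integrable by simp

lemma Y_square_expectation: "expectation (\<lambda>\<omega>. (Y k \<omega>)\<^sup>2) = step_var"
  using expectation_step[of "\<lambda>y. y\<^sup>2" k] by (simp add: step_var_def)

lemma Y_integrable: "integrable M (Y k)"
  by (rule square_integrable_imp_integrable[OF _ Y_square_integrable]) simp

lemma Y_expectation: "expectation (Y k) = 0"
  using expectation_step[of "\<lambda>y. y" k] mean_zero by simp

text \<open>A function of the whole path up to time \<open>n\<close> is needed here, and not only of the position, because the running maximum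
depends on the past.\<close>

lemma past_indep_step:
  assumes f: "f \<in> borel_measurable (Pi\<^sub>M {..<n} (\<lambda>_. borel :: real measure))"
    and g: "g \<in> borel_measurable borel"
  shows "indep_var borel (\<lambda>\<omega>. f (\<lambda>i\<in>{..<n}. Y i \<omega>) :: real) borel (\<lambda>\<omega>. g (Y n \<omega>) :: real)"
proof -
  have "indep_var (Pi\<^sub>M {..<n} (\<lambda>_. borel)) (\<lambda>\<omega>. \<lambda>i\<in>{..<n}. Y i \<omega>)
      (Pi\<^sub>M {n} (\<lambda>_. borel)) (\<lambda>\<omega>. \<lambda>i\<in>{n}. Y i \<omega>)"
    using indep by (rule indep_var_restrict) auto
  moreover have "(\<lambda>y. g (y n)) \<in> borel_measurable (Pi\<^sub>M {n} (\<lambda>_. borel))"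
    using g by measurable
  ultimately have "indep_var borel (f \<circ> (\<lambda>\<omega>. \<lambda>i\<in>{..<n}. Y i \<omega>))
      borel ((\<lambda>y. g (y n)) \<circ> (\<lambda>\<omega>. \<lambda>i\<in>{n}. Y i \<omega>))"
    using f by (intro indep_var_compose)
  then show ?thesis by (simp add: comp_def)
qed

lemma expectation_past_mult_step:
  assumes f: "f \<in> borel_measurable (Pi\<^sub>M {..<n} (\<lambda>_. borel :: real measure))"
    and int: "integrable M (\<lambda>\<omega>. f (\<lambda>i\<in>{..<n}. Y i \<omega>) :: real)"
  shows "integrable M (\<lambda>\<omega>. f (\<lambda>i\<in>{..<n}. Y i \<omega>) * Y n \<omega>)"
    and "expectation (\<lambda>\<omega>. f (\<lambda>i\<in>{..<n}. Y i \<omega>) * Y n \<omega>) = 0"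
proof -
  have "indep_var borel (\<lambda>\<omega>. f (\<lambda>i\<in>{..<n}. Y i \<omega>)) borel (Y n)"
    using past_indep_step[OF f, of "\<lambda>y. y"] by simp
  then show "integrable M (\<lambda>\<omega>. f (\<lambda>i\<in>{..<n}. Y i \<omega>) * Y n \<omega>)"
    "expectation (\<lambda>\<omega>. f (\<lambda>i\<in>{..<n}. Y i \<omega>) * Y n \<omega>) = 0"
    using indep_var_integrable[OF _ int Y_integrable]
      indep_var_lebesgue_integral[OF _ int Y_integrable] by (auto simp: Y_expectation)
qed

lemma W_restrict: "j \<le> n \<Longrightarrow> W j \<omega> = (\<Sum>k<j. (\<lambda>i\<in>{..<n}. Y i \<omega>) k)"
  unfolding W_def by (intro sum.cong) auto

text \<open>For a convex function \<open>\<phi>\<close> with subgradient \<open>g\<close>, the increment of \<open>\<phi> (W\<^sub>i)\<close> is at least \<open>g (W\<^sub>i) Y\<^sub>i\<close>.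
Multiplying by the running maximum, which is nonnegative and determined by the past, and using that \<open>Y\<^sub>i\<close> is centred
and independent of the past, every summand in the pathwise inequality has nonnegative expectation.\<close>

proposition doob_maximal:
  fixes \<phi> g :: "real \<Rightarrow> real"
  assumes [measurable]: "\<phi> \<in> borel_measurable borel" "g \<in> borel_measurable borel"
    and nonneg: "\<And>a. \<phi> a \<ge> 0" and subgradient: "\<And>a b. \<phi> b \<ge> \<phi> a + g a * (b - a)"
    and \<phi>_int: "\<And>j. integrable M (\<lambda>\<omega>. (\<phi> (W j \<omega>))\<^sup>2)"
    and g_int: "\<And>j. integrable M (\<lambda>\<omega>. (g (W j \<omega>))\<^sup>2)"
  shows "integrable M (\<lambda>\<omega>. (running_max (\<lambda>j. \<phi> (W j \<omega>)) n)\<^sup>2)"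
    and "expectation (\<lambda>\<omega>. (running_max (\<lambda>j. \<phi> (W j \<omega>)) n)\<^sup>2) \<le> 4 * expectation (\<lambda>\<omega>. (\<phi> (W n \<omega>))\<^sup>2)"
proof -
  define R where "R n \<omega> = running_max (\<lambda>j. \<phi> (W j \<omega>)) n" for n \<omega>
  have [measurable]: "R n \<in> borel_measurable M" for n unfolding R_def[abs_def] by measurable
  have R0: "R n \<omega> \<ge> 0" for n \<omega>
    using running_max_ge[of 0 n "\<lambda>j. \<phi> (W j \<omega>)"] nonneg[of "W 0 \<omega>"] unfolding R_def by linarith
  have R_int: "integrable M (\<lambda>\<omega>. (R n \<omega>)\<^sup>2)" for n
  proof (rule Bochner_Integration.integrable_bound)
    show "integrable M (\<lambda>\<omega>. \<Sum>j\<le>n. (\<phi> (W j \<omega>))\<^sup>2)" using \<phi>_int by simp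
    have "(R n \<omega>)\<^sup>2 \<le> (\<Sum>j\<le>n. (\<phi> (W j \<omega>))\<^sup>2)" for \<omega>
    proof -
      obtain j where "j \<le> n" "R n \<omega> = \<phi> (W j \<omega>)" unfolding R_def using running_max_attained by blast
      then show ?thesis using member_le_sum[of j "{..n}" "\<lambda>j. (\<phi> (W j \<omega>))\<^sup>2"] by simp
    qed
    then show "AE \<omega> in M. norm ((R n \<omega>)\<^sup>2) \<le> norm (\<Sum>j\<le>n. (\<phi> (W j \<omega>))\<^sup>2)"
      by (intro always_eventually allI) (simp add: sum_nonneg)
  qed simp
  have step_int: "integrable M (\<lambda>\<omega>. R i \<omega> * (\<phi> (W (Suc i) \<omega>) - \<phi> (W i \<omega>)))" for i
    unfolding right_diff_distrib
    by (intro Bochner_Integration.integrable_diff integrable_mult_of_squares R_int \<phi>_int) simp_all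
  have step: "0 \<le> expectation (\<lambda>\<omega>. R i \<omega> * (\<phi> (W (Suc i) \<omega>) - \<phi> (W i \<omega>)))" for i
  proof -
    let ?f = "\<lambda>y :: nat \<Rightarrow> real. running_max (\<lambda>j. \<phi> (\<Sum>k<j. y k)) i * g (\<Sum>k<i. y k)"
    have f: "R i \<omega> * g (W i \<omega>) = ?f (\<lambda>k\<in>{..<i}. Y k \<omega>)" for \<omega>
      unfolding R_def running_max_def
      by (intro arg_cong2[where f = "(*)"] arg_cong[of _ _ Max] arg_cong[of _ _ g] image_cong arg_cong[of _ _ \<phi>] W_restrict) auto
    have f_meas: "?f \<in> borel_measurable (Pi\<^sub>M {..<i} (\<lambda>_. borel))"
    proof -
      have [measurable]: "(\<lambda>y. \<Sum>k<j. y k) \<in> borel_measurable (Pi\<^sub>M {..<i} (\<lambda>_. borel :: real measure))"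
        if "j \<le> i" for j
        using that by (intro borel_measurable_sum measurable_component_singleton) auto
      show ?thesis
        by (intro borel_measurable_times running_max_measurable measurable_compose[OF _ assms(1)]
            measurable_compose[OF _ assms(2)]) measurable
    qed
    have f_int: "integrable M (\<lambda>\<omega>. ?f (\<lambda>k\<in>{..<i}. Y k \<omega>))"
      unfolding f[symmetric] by (intro integrable_mult_of_squares R_int g_int) simp_all
    have "0 = expectation (\<lambda>\<omega>. ?f (\<lambda>k\<in>{..<i}. Y k \<omega>) * Y i \<omega>)"
      by (rule expectation_past_mult_step(2)[OF f_meas f_int, symmetric])
    also have "\<dots> \<le> expectation (\<lambda>\<omega>. R i \<omega> * (\<phi> (W (Suc i) \<omega>) - \<phi> (W i \<omega>)))"
    proof (intro integral_mono expectation_past_mult_step(1) f_meas f_int step_int)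
      fix \<omega>
      have "g (W i \<omega>) * Y i \<omega> \<le> \<phi> (W (Suc i) \<omega>) - \<phi> (W i \<omega>)"
        using subgradient[of "W i \<omega>" "W (Suc i) \<omega>"] by (simp add: W_Suc)
      then have "R i \<omega> * g (W i \<omega>) * Y i \<omega> \<le> R i \<omega> * (\<phi> (W (Suc i) \<omega>) - \<phi> (W i \<omega>))"
        using R0 by (simp add: mult.assoc mult_left_mono)
      then show "?f (\<lambda>k\<in>{..<i}. Y k \<omega>) * Y i \<omega> \<le> R i \<omega> * (\<phi> (W (Suc i) \<omega>) - \<phi> (W i \<omega>))"
        by (simp only: f)
    qed
    finally show ?thesis .
  qed
  show "integrable M (\<lambda>\<omega>. (running_max (\<lambda>j. \<phi> (W j \<omega>)) n)\<^sup>2)" using R_int by (simp add: R_def)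
  have "expectation (\<lambda>\<omega>. (R n \<omega>)\<^sup>2) \<le> expectation (\<lambda>\<omega>. 4 * (\<phi> (W n \<omega>))\<^sup>2
      - 4 * (\<Sum>i<n. R i \<omega> * (\<phi> (W (Suc i) \<omega>) - \<phi> (W i \<omega>))))"
    by (intro integral_mono R_int Bochner_Integration.integrable_diff integrable_mult_right \<phi>_int
        Bochner_Integration.integrable_sum step_int)
      (auto simp: R_def intro: running_max_sq_le)
  also have "\<dots> = 4 * expectation (\<lambda>\<omega>. (\<phi> (W n \<omega>))\<^sup>2)
      - 4 * (\<Sum>i<n. expectation (\<lambda>\<omega>. R i \<omega> * (\<phi> (W (Suc i) \<omega>) - \<phi> (W i \<omega>))))"
    using step_int \<phi>_int by (simp add: Bochner_Integration.integral_sum)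
  also have "\<dots> \<le> 4 * expectation (\<lambda>\<omega>. (\<phi> (W n \<omega>))\<^sup>2)"
    using step by (simp add: sum_nonneg)
  finally show "expectation (\<lambda>\<omega>. (running_max (\<lambda>j. \<phi> (W j \<omega>)) n)\<^sup>2) \<le> 4 * expectation (\<lambda>\<omega>. (\<phi> (W n \<omega>))\<^sup>2)"
    by (simp add: R_def)
qed

lemma expectation_W_mult_step:
  fixes f g :: "real \<Rightarrow> real"
  assumes [measurable]: "f \<in> borel_measurable borel" "g \<in> borel_measurable borel"
    and f_int: "integrable M (\<lambda>\<omega>. f (W n \<omega>))" and g_int: "integrable M (\<lambda>\<omega>. g (Y n \<omega>))"
  shows "integrable M (\<lambda>\<omega>. f (W n \<omega>) * g (Y n \<omega>))"
    and "expectation (\<lambda>\<omega>. f (W n \<omega>) * g (Y n \<omega>)) = expectation (\<lambda>\<omega>. f (W n \<omega>)) * expectation (\<lambda>\<omega>. g (Y n \<omega>))"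
proof -
  have "(\<lambda>y. f (\<Sum>k<n. y k)) \<in> borel_measurable (Pi\<^sub>M {..<n} (\<lambda>_. borel :: real measure))" by measurable
  from past_indep_step[OF this assms(2)]
  have "indep_var borel (\<lambda>\<omega>. f (W n \<omega>)) borel (\<lambda>\<omega>. g (Y n \<omega>))"
    by (simp add: W_restrict[of n n])
  then show "integrable M (\<lambda>\<omega>. f (W n \<omega>) * g (Y n \<omega>))"
    "expectation (\<lambda>\<omega>. f (W n \<omega>) * g (Y n \<omega>)) = expectation (\<lambda>\<omega>. f (W n \<omega>)) * expectation (\<lambda>\<omega>. g (Y n \<omega>))"
    using indep_var_integrable[OF _ f_int g_int] indep_var_lebesgue_integral[OF _ f_int g_int] by auto
qed

lemma W_square_integrable: "integrable M (\<lambda>\<omega>. (W n \<omega>)\<^sup>2)"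
  and W_square_expectation: "expectation (\<lambda>\<omega>. (W n \<omega>)\<^sup>2) = real n * step_var"
proof (induction n)
  case (Suc n)
  have i: "integrable M (\<lambda>\<omega>. W n \<omega>)"
    by (rule square_integrable_imp_integrable[OF _ Suc(1)]) simp
  note cross = expectation_W_mult_step[of "\<lambda>x. x" "\<lambda>x. x", OF _ _ i Y_integrable, simplified Y_expectation]
  have eq: "(W (Suc n) \<omega>)\<^sup>2 = (W n \<omega>)\<^sup>2 + 2 * (W n \<omega> * Y n \<omega>) + (Y n \<omega>)\<^sup>2" for \<omega>
    by (simp add: W_Suc power2_eq_square algebra_simps)
  show "integrable M (\<lambda>\<omega>. (W (Suc n) \<omega>)\<^sup>2)"
    unfolding eq using Suc(1) cross Y_square_integrable[of n] by simp
  show "expectation (\<lambda>\<omega>. (W (Suc n) \<omega>)\<^sup>2) = real (Suc n) * step_var"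
    unfolding eq using Suc cross Y_square_integrable[of n]
    by (simp add: Y_square_expectation algebra_simps)
qed simp_all

lemma kolmogorov_maximal:
  shows "integrable M (\<lambda>\<omega>. (running_max (\<lambda>j. \<bar>W j \<omega>\<bar>) n)\<^sup>2)"
    and "expectation (\<lambda>\<omega>. (running_max (\<lambda>j. \<bar>W j \<omega>\<bar>) n)\<^sup>2) \<le> 4 * (real n * step_var)"
proof -
  have sg: "\<bar>a\<bar> + sgn a * (b - a) \<le> \<bar>b\<bar>" for a b :: real
    by (auto simp: sgn_if abs_if)
  have si: "integrable M (\<lambda>\<omega>. (sgn (W j \<omega>))\<^sup>2)" for j
    by (rule integrable_const_bound[of _ 1]) (auto simp: sgn_if)
  have [measurable]: "(sgn :: real \<Rightarrow> real) \<in> borel_measurable borel"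
    unfolding sgn_if[abs_def] by measurable
  show "integrable M (\<lambda>\<omega>. (running_max (\<lambda>j. \<bar>W j \<omega>\<bar>) n)\<^sup>2)"
    by (rule doob_maximal(1)[where \<phi> = abs and g = sgn]) (use sg si W_square_integrable in auto)
  have "expectation (\<lambda>\<omega>. (running_max (\<lambda>j. \<bar>W j \<omega>\<bar>) n)\<^sup>2) \<le> 4 * expectation (\<lambda>\<omega>. \<bar>W n \<omega>\<bar>\<^sup>2)"
    by (rule doob_maximal(2)[where \<phi> = abs and g = sgn]) (use sg si W_square_integrable in auto)
  then show "expectation (\<lambda>\<omega>. (running_max (\<lambda>j. \<bar>W j \<omega>\<bar>) n)\<^sup>2) \<le> 4 * (real n * step_var)"
    by (simp add: W_square_expectation)
qed

text \<open>The walk restarted at a later time is again such a walk, so the maximal inequality also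
controls the stretch of the path next to the final time.\<close>

lemma shifted_walk: "centred_walk M (\<lambda>k. Y (p + k))"
proof
  show "indep_vars (\<lambda>_. borel) (\<lambda>k. Y (p + k)) UNIV"
  proof -
    have "indep_vars (\<lambda>k. Pi\<^sub>M {p + k} (\<lambda>_. borel)) (\<lambda>k \<omega>. \<lambda>i\<in>{p + k}. Y i \<omega>) UNIV"
      using indep by (rule indep_vars_restrict) (auto simp: disjoint_family_on_def)
    then have "indep_vars (\<lambda>_. borel) (\<lambda>k \<omega>. (\<lambda>i\<in>{p + k}. Y i \<omega>) (p + k)) UNIV"
      by (rule indep_vars_compose2) (rule measurable_component_singleton, simp)
    then show ?thesis by simp
  qed
  show "distr M borel (Y (p + k)) = distr M borel (Y (p + 0))" for k
    using same_distr[of "p + k"] same_distr[of p] by simp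
  show "integrable M (\<lambda>\<omega>. (Y (p + 0) \<omega>)\<^sup>2)" by (rule Y_square_integrable)
  show "expectation (Y (p + 0)) = 0" by (rule Y_expectation)
qed

lemma kolmogorov_maximal_shifted:
  shows "integrable M (\<lambda>\<omega>. (running_max (\<lambda>j. \<bar>W (p + j) \<omega> - W p \<omega>\<bar>) n)\<^sup>2)"
    and "expectation (\<lambda>\<omega>. (running_max (\<lambda>j. \<bar>W (p + j) \<omega> - W p \<omega>\<bar>) n)\<^sup>2) \<le> 4 * (real n * step_var)"
proof -
  interpret S: centred_walk M "\<lambda>k. Y (p + k)" by (rule shifted_walk)
  have "W (p + j) \<omega> - W p \<omega> = S.W j \<omega>" for j \<omega>
    by (induction j) (simp_all add: W_Suc S.W_Suc)
  moreover have "S.step_var = step_var" unfolding S.step_var_def by (simp add: Y_square_expectation)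
  ultimately show "integrable M (\<lambda>\<omega>. (running_max (\<lambda>j. \<bar>W (p + j) \<omega> - W p \<omega>\<bar>) n)\<^sup>2)"
    "expectation (\<lambda>\<omega>. (running_max (\<lambda>j. \<bar>W (p + j) \<omega> - W p \<omega>\<bar>) n)\<^sup>2) \<le> 4 * (real n * step_var)"
    using S.kolmogorov_maximal[of n] by simp_all
qed

end

section \<open>The weak limit\<close>

text \<open>The piecewise linear test functions \<open>cts_step\<close> suffice for weak convergence; the bound is stated with
\<open>min 1 \<bar>x - y\<bar>\<close> because the expectation of this quantity metrizes convergence in probability.\<close>

lemma cts_step_Lipschitz:
  assumes "a < b"
  shows "\<bar>cts_step a b x - cts_step a b y\<bar> \<le> max 1 (1 / (b - a)) * min 1 \<bar>x - y\<bar>"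
proof -
  have range: "0 \<le> cts_step a b z \<and> cts_step a b z \<le> 1" for z
    using assms by (auto simp: cts_step_def divide_simps)
  have bd: "\<bar>cts_step a b x - cts_step a b y\<bar> \<le> 1"
    using range[of x] range[of y] by linarith
  have lip: "\<bar>cts_step a b x - cts_step a b y\<bar> \<le> 1 / (b - a) * \<bar>x - y\<bar>"
    using assms by (auto simp: cts_step_def divide_simps abs_if)
  show ?thesis
  proof (cases "\<bar>x - y\<bar> \<le> 1")
    case True
    have "1 / (b - a) * \<bar>x - y\<bar> \<le> max 1 (1 / (b - a)) * \<bar>x - y\<bar>" by (intro mult_right_mono) auto
    with True lip show ?thesis by (simp add: min_def)
  next
    case False
    with bd show ?thesis by (simp add: min_def)
  qed
qed

text \<open>Slutsky's theorem: a sequence that is close in probability to one converging weakly has the same limit.\<close>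

lemma (in prob_space) weak_conv_m_approximation:
  fixes T U :: "nat \<Rightarrow> 'a \<Rightarrow> real"
  assumes [measurable]: "\<And>n. T n \<in> borel_measurable M" "\<And>n. U n \<in> borel_measurable M"
    and \<nu>: "real_distribution \<nu>"
    and conv: "\<And>f. (\<And>x. isCont f x) \<Longrightarrow> (\<And>x. \<bar>f x\<bar> \<le> 1) \<Longrightarrow>
        (\<lambda>n. expectation (\<lambda>\<omega>. f (U n \<omega>)) :: real) \<longlonglongrightarrow> integral\<^sup>L \<nu> f"
    and close: "(\<lambda>n. expectation (\<lambda>\<omega>. min 1 \<bar>T n \<omega> - U n \<omega>\<bar>)) \<longlonglongrightarrow> 0"
  shows "weak_conv_m (\<lambda>n. distr M borel (T n)) \<nu>"
proof (rule integral_cts_step_conv_imp_weak_conv)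
  fix a b :: real assume ab: "a < b"
  let ?f = "cts_step a b"
  define L where "L = max 1 (1 / (b - a))"
  have cont: "isCont ?f x" for x
    using uniformly_continuous_imp_continuous[OF cts_step_uniformly_continuous[OF ab]]
    by (simp add: continuous_on_eq_continuous_at)
  then have [measurable]: "?f \<in> borel_measurable borel"
    by (intro borel_measurable_continuous_onI continuous_at_imp_continuous_on) auto
  have bd: "\<bar>?f x\<bar> \<le> 1" for x using ab by (auto simp: cts_step_def divide_simps)
  have f_int: "integrable M (\<lambda>\<omega>. ?f (V \<omega>))" if [measurable]: "V \<in> borel_measurable M" for V
    using bd by (intro integrable_const_bound[of _ 1]) auto
  have min_int: "integrable M (\<lambda>\<omega>. min 1 \<bar>T n \<omega> - U n \<omega>\<bar>)" for n
    by (intro integrable_const_bound[of _ 1]) auto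
  have bound: "\<bar>expectation (\<lambda>\<omega>. ?f (T n \<omega>)) - expectation (\<lambda>\<omega>. ?f (U n \<omega>))\<bar>
      \<le> L * expectation (\<lambda>\<omega>. min 1 \<bar>T n \<omega> - U n \<omega>\<bar>)" for n
  proof -
    have "\<bar>expectation (\<lambda>\<omega>. ?f (T n \<omega>)) - expectation (\<lambda>\<omega>. ?f (U n \<omega>))\<bar>
        = \<bar>expectation (\<lambda>\<omega>. ?f (T n \<omega>) - ?f (U n \<omega>))\<bar>"
      using f_int by simp
    also have "\<dots> \<le> expectation (\<lambda>\<omega>. \<bar>?f (T n \<omega>) - ?f (U n \<omega>)\<bar>)" by (rule integral_abs_bound)
    also have "\<dots> \<le> expectation (\<lambda>\<omega>. L * min 1 \<bar>T n \<omega> - U n \<omega>\<bar>)"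
      using f_int min_int cts_step_Lipschitz[OF ab] unfolding L_def by (intro integral_mono) auto
    finally show ?thesis by simp
  qed
  have "(\<lambda>n. L * expectation (\<lambda>\<omega>. min 1 \<bar>T n \<omega> - U n \<omega>\<bar>)) \<longlonglongrightarrow> 0"
    using tendsto_mult_right_zero[OF close] by simp
  then have "(\<lambda>n. expectation (\<lambda>\<omega>. ?f (T n \<omega>)) - expectation (\<lambda>\<omega>. ?f (U n \<omega>))) \<longlonglongrightarrow> 0"
    by (rule Lim_null_comparison[OF always_eventually, rotated]) (use bound in simp)
  then have "(\<lambda>n. expectation (\<lambda>\<omega>. ?f (T n \<omega>)) - expectation (\<lambda>\<omega>. ?f (U n \<omega>))
      + expectation (\<lambda>\<omega>. ?f (U n \<omega>))) \<longlonglongrightarrow> 0 + integral\<^sup>L \<nu> ?f"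
    using cont bd by (intro tendsto_add conv) auto
  then show "(\<lambda>n. integral\<^sup>L (distr M borel (T n)) ?f) \<longlonglongrightarrow> integral\<^sup>L \<nu> ?f"
    by (simp add: integral_distr)
next
  show "real_distribution (distr M borel (T n))" for n by (rule real_distribution_distr) simp
qed (rule \<nu>)

context centred_walk
begin

text \<open>The central limit theorem tested against a bounded continuous function. Normalizing by \<open>sqrt n\<close> and not by the
standard deviation includes the degenerate case in which all steps vanish almost surely.\<close>

lemma clt_test_function:
  fixes f :: "real \<Rightarrow> real"
  assumes cont: "\<And>x. isCont f x" and bounded: "\<And>x. \<bar>f x\<bar> \<le> B"
  shows "(\<lambda>n. expectation (\<lambda>\<omega>. f (W n \<omega> / sqrt n)))
    \<longlonglongrightarrow> (LINT x|std_normal_distribution. f (sqrt step_var * x))"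
proof (cases "step_var = 0")
  case True
  interpret N: real_distribution std_normal_distribution by (rule real_dist_normal_dist)
  have "AE \<omega> in M. (W n \<omega>)\<^sup>2 = 0" for n
    using W_square_integrable[of n] W_square_expectation[of n] True
    by (subst integral_nonneg_eq_0_iff_AE[symmetric]) auto
  then have "AE \<omega> in M. f (W n \<omega> / sqrt n) = f 0" for n by (rule AE_mp[where P = "\<lambda>\<omega>. (W n \<omega>)\<^sup>2 = 0"]) simp
  moreover have [measurable]: "f \<in> borel_measurable borel"
    using cont by (intro borel_measurable_continuous_onI continuous_at_imp_continuous_on) auto
  ultimately have "expectation (\<lambda>\<omega>. f (W n \<omega> / sqrt n)) = expectation (\<lambda>\<omega>. f 0)" for n
    by (intro integral_cong_AE) auto
  then show ?thesis using True N.prob_space by (simp add: prob_space)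
next
  case False
  then have step_var: "step_var > 0" using step_var_nonneg by simp
  define F where "F x = f (sqrt step_var * x)" for x
  have "weak_conv_m (\<lambda>n. distr M borel (\<lambda>x. (\<Sum>i<n. Y i x) / sqrt (n * (sqrt step_var)\<^sup>2))) std_normal_distribution"
    using indep Y_expectation Y_square_integrable same_distr step_var
    by (intro central_limit_theorem_zero_mean[where \<mu> = "distr M borel (Y 0)"])
      (auto simp: Y_square_expectation)
  then have clt: "weak_conv_m (\<lambda>n. distr M borel (\<lambda>x. W n x / sqrt (n * step_var))) std_normal_distribution"
    using step_var by (simp add: W_def)
  have [measurable]: "f \<in> borel_measurable borel"
    using cont by (intro borel_measurable_continuous_onI continuous_at_imp_continuous_on) auto
  have [measurable]: "F \<in> borel_measurable borel" unfolding F_def[abs_def] by measurable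
  have F_eq: "F (W n \<omega> / sqrt (n * step_var)) = f (W n \<omega> / sqrt n)" for n \<omega>
    using step_var by (simp add: F_def real_sqrt_mult)
  have "(\<lambda>n. integral\<^sup>L (distr M borel (\<lambda>x. W n x / sqrt (n * step_var))) F) \<longlonglongrightarrow> integral\<^sup>L std_normal_distribution F"
  proof (rule weak_conv_imp_integral_bdd_continuous_conv[OF _ _ clt])
    show "isCont F x" for x unfolding F_def by (intro isCont_o2[OF _ cont] continuous_intros)
    show "norm (F x) \<le> B" for x using bounded by (simp add: F_def)
  qed (simp_all add: real_dist_normal_dist)
  then show ?thesis by (simp add: integral_distr F_eq) (simp add: F_def[abs_def])
qed

text \<open>In expectation, the square of the maximum over \<open>l\<close> steps is at most \<open>4 l\<close> times the step variance. The
threshold \<open>\<rho>\<close> must be large against \<open>sqrt n\<close>, for the first term of the bound on the truncated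
remainder, and small against \<open>n\<close>; the weight \<open>\<delta>\<close> must tend to zero, but more slowly than \<open>\<rho> / n\<close>. The
exponents \<open>3/4\<close> and \<open>-1/8\<close> do this.\<close>

lemma excess_tendsto_in_probability:
  assumes m: "m > 0"
  shows "(\<lambda>n. expectation (\<lambda>\<omega>. min 1 \<bar>excess m (\<lambda>j. W j \<omega>) n\<bar>)) \<longlonglongrightarrow> 0"
proof -
  define \<rho> where "\<rho> n = real n powr (3/4)" for n
  define \<delta> where "\<delta> n = real n powr (-1/8)" for n
  define bd where "bd n = 16 * step_var / m\<^sup>2 * (n / (\<rho> n)\<^sup>2)
      + step_var / (2 * m) * (((1 + \<delta> n) * n + (1 + 1 / \<delta> n) * (40 * \<rho> n)) / (n - \<rho> n) - 1)
      + step_var / (2 * m * sqrt (2 * m)) * (1 / sqrt n)" for n :: nat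
  have "(\<lambda>n::nat. n / (\<rho> n)\<^sup>2) \<longlonglongrightarrow> 0" unfolding \<rho>_def by real_asymp
  moreover have "(\<lambda>n::nat. ((1 + \<delta> n) * n + (1 + 1 / \<delta> n) * (40 * \<rho> n)) / (n - \<rho> n) - 1) \<longlonglongrightarrow> 0"
    unfolding \<rho>_def \<delta>_def by real_asymp
  moreover have "(\<lambda>n::nat. 1 / sqrt n) \<longlonglongrightarrow> 0" by real_asymp
  ultimately have bd: "bd \<longlonglongrightarrow> 0"
    unfolding bd_def[abs_def] by (intro tendsto_add_zero tendsto_mult_right_zero)
  have upper: "\<forall>\<^sub>F n in sequentially. expectation (\<lambda>\<omega>. min 1 \<bar>excess m (\<lambda>j. W j \<omega>) n\<bar>) \<le> bd n"
  proof (rule eventually_sequentiallyI[of 2])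
    fix n :: nat assume n: "n \<ge> 2"
    define r where "r = nat \<lfloor>\<rho> n\<rfloor>"
    have "real n powr (3/4) < real n powr 1" using n by (intro powr_less_mono) auto
    then have \<rho>: "0 < \<rho> n" "\<rho> n < n" using n by (auto simp: \<rho>_def)
    have \<delta>: "\<delta> n > 0" using n by (simp add: \<delta>_def)
    have r: "real r \<le> \<rho> n" using \<rho> unfolding r_def by linarith
    let ?A = "\<lambda>\<omega>. (running_max (\<lambda>j. \<bar>W j \<omega>\<bar>) n)\<^sup>2" and ?B = "\<lambda>\<omega>. (running_max (\<lambda>j. \<bar>W j \<omega>\<bar>) r)\<^sup>2"
      and ?C = "\<lambda>\<omega>. (running_max (\<lambda>j. \<bar>W (n - r + j) \<omega> - W (n - r) \<omega>\<bar>) r)\<^sup>2"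
    let ?R = "\<lambda>a w b c. 4 / (m * \<rho> n)\<^sup>2 * a
      + (((1 + \<delta> n) * w + (1 + 1 / \<delta> n) * (2 * b + 8 * c)) / (n - \<rho> n) - w / n) / (2 * m)
      + w / (2 * m * n * sqrt (2 * m * n)) :: real"
    note ints = kolmogorov_maximal(1)[of n] kolmogorov_maximal(1)[of r] kolmogorov_maximal_shifted(1)[of "n - r" r]
      W_square_integrable[of n]
    have "expectation (\<lambda>\<omega>. min 1 \<bar>excess m (\<lambda>j. W j \<omega>) n\<bar>)
        \<le> expectation (\<lambda>\<omega>. ?R (?A \<omega>) ((W n \<omega>)\<^sup>2) (?B \<omega>) (?C \<omega>))"
    proof (rule integral_mono)
      show "integrable M (\<lambda>\<omega>. min 1 \<bar>excess m (\<lambda>j. W j \<omega>) n\<bar>)"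
        by (intro integrable_const_bound[of _ 1]) auto
      show "integrable M (\<lambda>\<omega>. ?R (?A \<omega>) ((W n \<omega>)\<^sup>2) (?B \<omega>) (?C \<omega>))" using ints by simp
      show "min 1 \<bar>excess m (\<lambda>j. W j \<omega>) n\<bar> \<le> ?R (?A \<omega>) ((W n \<omega>)\<^sup>2) (?B \<omega>) (?C \<omega>)" for \<omega>
        using truncated_excess_le[OF m r_def \<rho> \<delta>, of "\<lambda>j. W j \<omega>"] by simp
    qed
    also have "\<dots> = ?R (expectation ?A) (real n * step_var) (expectation ?B) (expectation ?C)"
      using ints by (simp add: W_square_expectation)
    also have "\<dots> \<le> bd n"
    proof -
      have "expectation ?B \<le> 4 * (\<rho> n * step_var)" "expectation ?C \<le> 4 * (\<rho> n * step_var)"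
        using kolmogorov_maximal(2)[of r] kolmogorov_maximal_shifted(2)[of "n - r" r]
          mult_right_mono[OF r step_var_nonneg] by linarith+
      \<comment> \<open>The constant is \<open>40 = 2 * 4 + 8 * 4\<close>.\<close>
      then have "2 * expectation ?B + 8 * expectation ?C \<le> 40 * (\<rho> n * step_var)" by linarith
      then have "?R (expectation ?A) (real n * step_var) (expectation ?B) (expectation ?C)
          \<le> 4 / (m * \<rho> n)\<^sup>2 * (4 * (real n * step_var))
            + (((1 + \<delta> n) * (real n * step_var) + (1 + 1 / \<delta> n) * (40 * (\<rho> n * step_var))) / (n - \<rho> n) - real n * step_var / n) / (2 * m)
            + real n * step_var / (2 * m * n * sqrt (2 * m * n))" (is "_ \<le> ?b1 + ?b2 + ?b3")
      proof -
        assume BC: "2 * expectation ?B + 8 * expectation ?C \<le> 40 * (\<rho> n * step_var)"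
        have "4 / (m * \<rho> n)\<^sup>2 * expectation ?A \<le> ?b1"
          by (rule mult_left_mono[OF kolmogorov_maximal(2)]) simp
        moreover have "(1 + 1 / \<delta> n) * (2 * expectation ?B + 8 * expectation ?C) \<le> (1 + 1 / \<delta> n) * (40 * (\<rho> n * step_var))"
          using \<delta> by (intro mult_left_mono[OF BC]) simp
        then have "(((1 + \<delta> n) * (real n * step_var) + (1 + 1 / \<delta> n) * (2 * expectation ?B + 8 * expectation ?C)) / (n - \<rho> n)
            - real n * step_var / n) / (2 * m) \<le> ?b2"
          using m \<rho> by (intro divide_right_mono diff_right_mono add_left_mono) simp_all
        ultimately show ?thesis by (intro add_right_mono add_mono)
      qed
      moreover have "?b1 = 16 * step_var / m\<^sup>2 * (n / (\<rho> n)\<^sup>2)"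
        by (simp add: power_mult_distrib)
      moreover have "?b2 = step_var / (2 * m) * (((1 + \<delta> n) * n + (1 + 1 / \<delta> n) * (40 * \<rho> n)) / (n - \<rho> n) - 1)"
      proof -
        have "real n * step_var / n = step_var" using n by simp
        moreover have "(1 + \<delta> n) * (real n * step_var) + (1 + 1 / \<delta> n) * (40 * (\<rho> n * step_var))
            = step_var * ((1 + \<delta> n) * n + (1 + 1 / \<delta> n) * (40 * \<rho> n))"
          by (simp add: distrib_left mult_ac)
        moreover have "(step_var * q / d - step_var) / c = step_var / c * (q / d - 1)" for q d c :: real
          by (simp add: diff_divide_distrib right_diff_distrib)
        ultimately show ?thesis by (simp only:)
      qed
      moreover have "?b3 = step_var / (2 * m * sqrt (2 * m)) * (1 / sqrt n)"
        using n m by (simp add: real_sqrt_mult)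
      ultimately show ?thesis unfolding bd_def by (simp only:)
    qed
    finally show "expectation (\<lambda>\<omega>. min 1 \<bar>excess m (\<lambda>j. W j \<omega>) n\<bar>) \<le> bd n" .
  qed
  have lower: "\<forall>\<^sub>F n in sequentially. 0 \<le> expectation (\<lambda>\<omega>. min 1 \<bar>excess m (\<lambda>j. W j \<omega>) n\<bar>)"
    by (intro always_eventually allI Bochner_Integration.integral_nonneg) simp
  show ?thesis by (rule tendsto_sandwich[OF lower upper tendsto_const bd])
qed

theorem graph_diam_weak_limit:
  assumes m: "m > 0"
  shows "weak_conv_m (\<lambda>n. distr M borel (\<lambda>\<omega>. graph_diam m (\<lambda>j. W j \<omega>) n - m * real n))
    (distr std_normal_distribution borel (\<lambda>x. step_var * x\<^sup>2 / (2 * m)))"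
proof (rule weak_conv_m_approximation[where U = "\<lambda>n \<omega>. (W n \<omega> / sqrt n)\<^sup>2 / (2 * m)"])
  let ?U = "\<lambda>n \<omega>. (W n \<omega> / sqrt n)\<^sup>2 / (2 * m)"
  interpret N: real_distribution std_normal_distribution by (rule real_dist_normal_dist)
  show "real_distribution (distr std_normal_distribution borel (\<lambda>x. step_var * x\<^sup>2 / (2 * m)))"
    by (rule N.real_distribution_distr) simp
  show "(\<lambda>n. expectation (\<lambda>\<omega>. f (?U n \<omega>))) \<longlonglongrightarrow>
      integral\<^sup>L (distr std_normal_distribution borel (\<lambda>x. step_var * x\<^sup>2 / (2 * m))) f"
    if cont: "\<And>x. isCont f x" and bd: "\<And>x. \<bar>f x\<bar> \<le> 1" for f :: "real \<Rightarrow> real"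
  proof -
    have [measurable]: "f \<in> borel_measurable borel"
      using cont by (intro borel_measurable_continuous_onI continuous_at_imp_continuous_on) auto
    have "(\<lambda>n. expectation (\<lambda>\<omega>. f ((W n \<omega> / sqrt n)\<^sup>2 / (2 * m)))) \<longlonglongrightarrow>
        (LINT x|std_normal_distribution. f ((sqrt step_var * x)\<^sup>2 / (2 * m)))"
    proof (rule clt_test_function)
      show "isCont (\<lambda>x. f (x\<^sup>2 / (2 * m))) x" for x
        using m by (intro isCont_o2[OF _ cont] continuous_intros) auto
    qed (rule bd)
    then show ?thesis using step_var_nonneg by (simp add: integral_distr power_mult_distrib)
  qed
  have "excess m (\<lambda>j. W j \<omega>) n = graph_diam m (\<lambda>j. W j \<omega>) n - m * real n - ?U n \<omega>" for n \<omega>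
    by (simp add: excess_def power_divide mult.commute)
  then show "(\<lambda>n. expectation (\<lambda>\<omega>. min 1 \<bar>graph_diam m (\<lambda>j. W j \<omega>) n - m * real n - ?U n \<omega>\<bar>)) \<longlonglongrightarrow> 0"
    using excess_tendsto_in_probability[OF m] by simp
  show "(\<lambda>\<omega>. graph_diam m (\<lambda>j. W j \<omega>) n - m * real n) \<in> borel_measurable M" for n
    by simp
  show "?U n \<in> borel_measurable M" for n
    by simp
qed

end

section \<open>Fourth moments and uniform integrability\<close>

lemma std_normal_square_moments:
  shows "integrable std_normal_distribution (\<lambda>x. x\<^sup>2)" "(LINT x|std_normal_distribution. x\<^sup>2) = 1"
    and "integrable std_normal_distribution (\<lambda>x. x ^ 4)" "(LINT x|std_normal_distribution. x ^ 4) = 3"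
    and "integrable std_normal_distribution (\<lambda>x. x ^ 6)" "(LINT x|std_normal_distribution. x ^ 6) = 15"
proof -
  note ev = std_normal_distribution_even_moments
  show "integrable std_normal_distribution (\<lambda>x. x\<^sup>2)" "(LINT x|std_normal_distribution. x\<^sup>2) = 1"
    using ev[of 1] by simp_all
  show "integrable std_normal_distribution (\<lambda>x. x ^ 4)" "(LINT x|std_normal_distribution. x ^ 4) = 3"
    using ev[of 2] by (simp_all add: fact_numeral)
  show "integrable std_normal_distribution (\<lambda>x. x ^ 6)" "(LINT x|std_normal_distribution. x ^ 6) = 15"
    using ev[of 3] by (simp_all add: fact_numeral)
qed

text \<open>All terms on the right are either powers of \<open>v\<close> or bounded and continuous in \<open>v\<close>, so weak convergence together
with convergence of the second and fourth moments gives convergence of the left-hand side.\<close>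

lemma pos_part_square_eq:
  fixes v K :: real
  shows "(max 0 (v\<^sup>2 - K))\<^sup>2 = v ^ 4 - 2 * K * v\<^sup>2 + K\<^sup>2 - (max 0 (K - v\<^sup>2))\<^sup>2"
proof -
  have "(max 0 (v\<^sup>2 - K))\<^sup>2 + (max 0 (K - v\<^sup>2))\<^sup>2 = (v\<^sup>2 - K)\<^sup>2"
    by (auto simp: max_def power2_commute)
  also have "\<dots> = v ^ 4 - 2 * K * v\<^sup>2 + K\<^sup>2"
    by (simp add: power2_diff power_mult[symmetric])
  finally show ?thesis by simp
qed

text \<open>Where the left-hand side does not vanish, \<open>v\<^sup>2 / K\<close> is at least \<open>1\<close>. The sixth moment is available because
this is applied to the normal law only.\<close>

lemma pos_part_square_le:
  fixes v K :: real assumes "K > 0"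
  shows "(max 0 (v\<^sup>2 - K))\<^sup>2 \<le> v ^ 6 / K"
proof (cases "v\<^sup>2 \<le> K")
  case True
  have "0 \<le> (v ^ 3)\<^sup>2" by simp
  then show ?thesis using True assms by (simp add: max_def power_mult[symmetric])
next
  case False
  then have "(max 0 (v\<^sup>2 - K))\<^sup>2 \<le> (v\<^sup>2)\<^sup>2" using assms by (intro power_mono) auto
  also have "\<dots> = (v\<^sup>2)\<^sup>2 * 1" by simp
  also have "\<dots> \<le> (v\<^sup>2)\<^sup>2 * (v\<^sup>2 / K)" using False assms by (intro mult_left_mono) simp_all
  also have "\<dots> = v ^ 6 / K" by (simp add: power_mult[symmetric] power_add[symmetric])
  finally show ?thesis .
qed

lemma (in prob_space) integrable_power_of_fourth:
  fixes f :: "'a \<Rightarrow> real"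
  assumes [measurable]: "f \<in> borel_measurable M" and "integrable M (\<lambda>\<omega>. (f \<omega>) ^ 4)" and "k \<le> 4"
  shows "integrable M (\<lambda>\<omega>. (f \<omega>) ^ k)"
proof (rule Bochner_Integration.integrable_bound)
  show "integrable M (\<lambda>\<omega>. 1 + (f \<omega>) ^ 4)" using assms by simp
  have "\<bar>x ^ k\<bar> \<le> 1 + x ^ 4" for x :: real
  proof (cases "\<bar>x\<bar> \<le> 1")
    case True
    then have "\<bar>x\<bar> ^ k \<le> 1" by (simp add: power_le_one)
    moreover have "0 \<le> x ^ 4" by simp
    ultimately show ?thesis unfolding power_abs by linarith
  next
    case False
    then have "\<bar>x\<bar> ^ k \<le> \<bar>x\<bar> ^ 4" using \<open>k \<le> 4\<close> by (intro power_increasing) auto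
    then show ?thesis by (simp add: power_abs)
  qed
  then show "AE \<omega> in M. norm ((f \<omega>) ^ k) \<le> norm (1 + (f \<omega>) ^ 4)"
    by (intro always_eventually allI) simp
qed simp

locale centred_walk_4 = centred_walk +
  assumes fourth_integrable: "integrable M (\<lambda>\<omega>. (Y 0 \<omega>) ^ 4)"
begin

definition step_fourth :: real where "step_fourth = expectation (\<lambda>\<omega>. (Y 0 \<omega>) ^ 4)"

lemma Y_power_integrable: "k \<le> 4 \<Longrightarrow> integrable M (\<lambda>\<omega>. (Y n \<omega>) ^ k)"
  using integrable_step_iff[of "\<lambda>y. y ^ 4" n] fourth_integrable
  by - (rule integrable_power_of_fourth, simp_all)

lemma Y_fourth_expectation: "expectation (\<lambda>\<omega>. (Y n \<omega>) ^ 4) = step_fourth"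
  using expectation_step[of "\<lambda>y. y ^ 4" n] by (simp add: step_fourth_def)

lemma W_fourth_integrable: "integrable M (\<lambda>\<omega>. (W n \<omega>) ^ 4)"
  and W_fourth_expectation:
    "expectation (\<lambda>\<omega>. (W n \<omega>) ^ 4) = real n * step_fourth + 3 * real n * (real n - 1) * step_var\<^sup>2"
proof (induction n)
  case (Suc n)
  have i: "integrable M (\<lambda>\<omega>. (W n \<omega>) ^ k)" if "k \<le> 4" for k
    by (rule integrable_power_of_fourth[OF _ Suc(1) that]) simp
  have cross: "integrable M (\<lambda>\<omega>. (W n \<omega>) ^ j * (Y n \<omega>) ^ k)"
    "expectation (\<lambda>\<omega>. (W n \<omega>) ^ j * (Y n \<omega>) ^ k) = expectation (\<lambda>\<omega>. (W n \<omega>) ^ j) * expectation (\<lambda>\<omega>. (Y n \<omega>) ^ k)"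
    if "j \<le> 4" "k \<le> 4" for j k
    using expectation_W_mult_step[of "\<lambda>x. x ^ j" "\<lambda>x. x ^ k" n] i[OF that(1)] Y_power_integrable[OF that(2), of n]
    by simp_all
  have W1: "expectation (W n) = 0"
    unfolding W_def[abs_def] using Y_integrable by (simp add: Bochner_Integration.integral_sum Y_expectation)
  have eq: "(W (Suc n) \<omega>) ^ 4 = (W n \<omega>) ^ 4 + 4 * ((W n \<omega>) ^ 3 * (Y n \<omega>) ^ 1) + 6 * ((W n \<omega>) ^ 2 * (Y n \<omega>) ^ 2)
      + 4 * ((W n \<omega>) ^ 1 * (Y n \<omega>) ^ 3) + (Y n \<omega>) ^ 4" for \<omega>
    unfolding W_Suc by (simp add: power_numeral_reduce algebra_simps)
  have e: "integrable M (\<lambda>\<omega>. (W n \<omega>) ^ 3 * (Y n \<omega>) ^ 1)" "expectation (\<lambda>\<omega>. (W n \<omega>) ^ 3 * (Y n \<omega>) ^ 1) = 0"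
    "integrable M (\<lambda>\<omega>. (W n \<omega>) ^ 2 * (Y n \<omega>) ^ 2)" "expectation (\<lambda>\<omega>. (W n \<omega>) ^ 2 * (Y n \<omega>) ^ 2) = real n * step_var * step_var"
    "integrable M (\<lambda>\<omega>. (W n \<omega>) ^ 1 * (Y n \<omega>) ^ 3)" "expectation (\<lambda>\<omega>. (W n \<omega>) ^ 1 * (Y n \<omega>) ^ 3) = 0"
    using cross[of 3 1] cross[of 2 2] cross[of 1 3]
    by (simp_all add: Y_expectation W1 Y_square_expectation W_square_expectation)
  show "integrable M (\<lambda>\<omega>. (W (Suc n) \<omega>) ^ 4)"
    unfolding eq using Suc(1) e Y_power_integrable[of 4 n]
    by (intro Bochner_Integration.integrable_add integrable_mult_right) simp_all
  have "expectation (\<lambda>\<omega>. (W (Suc n) \<omega>) ^ 4) = expectation (\<lambda>\<omega>. (W n \<omega>) ^ 4)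
      + 4 * expectation (\<lambda>\<omega>. (W n \<omega>) ^ 3 * (Y n \<omega>) ^ 1) + 6 * expectation (\<lambda>\<omega>. (W n \<omega>) ^ 2 * (Y n \<omega>) ^ 2)
      + 4 * expectation (\<lambda>\<omega>. (W n \<omega>) ^ 1 * (Y n \<omega>) ^ 3) + expectation (\<lambda>\<omega>. (Y n \<omega>) ^ 4)"
    unfolding eq using Suc(1) e(1,3,5) Y_power_integrable[OF order_refl, of n]
    by (simp only: Bochner_Integration.integral_add integral_mult_right_zero Bochner_Integration.integrable_add
        integrable_mult_right)
  then have "expectation (\<lambda>\<omega>. (W (Suc n) \<omega>) ^ 4) = expectation (\<lambda>\<omega>. (W n \<omega>) ^ 4) + 6 * (real n * step_var * step_var) + step_fourth"
    unfolding e(2,4,6) Y_fourth_expectation by simp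
  then show "expectation (\<lambda>\<omega>. (W (Suc n) \<omega>) ^ 4) = real (Suc n) * step_fourth + 3 * real (Suc n) * (real (Suc n) - 1) * step_var\<^sup>2"
    using Suc(2) by (simp add: power2_eq_square algebra_simps)
qed simp_all

lemma truncated_square_integrable: "integrable M (\<lambda>\<omega>. (max 0 ((W n \<omega>)\<^sup>2 - c))\<^sup>2)"
proof -
  have "integrable M (\<lambda>\<omega>. (max 0 (c - (W n \<omega>)\<^sup>2))\<^sup>2)"
  proof (rule integrable_const_bound[of _ "c\<^sup>2"])
    have "(max 0 (c - x\<^sup>2))\<^sup>2 \<le> c\<^sup>2" for x
      by (cases "c - x\<^sup>2 \<ge> 0") (auto simp: max_def intro!: power_mono)
    then show "AE \<omega> in M. norm ((max 0 (c - (W n \<omega>)\<^sup>2))\<^sup>2) \<le> c\<^sup>2" by simp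
  qed simp
  then show ?thesis unfolding pos_part_square_eq
    using W_fourth_integrable[of n] W_square_integrable[of n] by simp
qed

text \<open>Uniform integrability of \<open>(W\<^sub>n\<^sup>2 / n)\<^sup>2\<close>, in a form with an explicit tail: \<open>\<tau>\<close> is the same expectation for the
normal limit, and the constant \<open>15\<close> is the sixth moment of the standard normal law.\<close>

lemma truncated_square_tendsto:
  assumes K: "K > 0"
  shows "\<exists>\<tau>. \<tau> \<le> 15 * step_var ^ 3 / K \<and> (\<lambda>n. expectation (\<lambda>\<omega>. (max 0 ((W n \<omega>)\<^sup>2 / n - K))\<^sup>2)) \<longlonglongrightarrow> \<tau>"
proof -
  interpret N: real_distribution std_normal_distribution by (rule real_dist_normal_dist)
  define \<tau> where "\<tau> = (LINT x|std_normal_distribution. (max 0 ((sqrt step_var * x)\<^sup>2 - K))\<^sup>2)"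
  let ?g = "\<lambda>v :: real. (max 0 (K - v\<^sup>2))\<^sup>2"
  have g_bd: "\<bar>?g v\<bar> \<le> K\<^sup>2" for v
    using K by (cases "K - v\<^sup>2 \<ge> 0") (auto simp: max_def intro!: power_mono)
  have [measurable]: "?g \<in> borel_measurable borel" by measurable
  have N_sq: "(\<lambda>x. (sqrt step_var * x)\<^sup>2) = (\<lambda>x. step_var * x\<^sup>2)" and N_four: "(\<lambda>x. (sqrt step_var * x) ^ 4) = (\<lambda>x. step_var\<^sup>2 * x ^ 4)"
    and N_six: "(\<lambda>x. (sqrt step_var * x) ^ 6) = (\<lambda>x. step_var ^ 3 * x ^ 6)"
  proof -
    have "sqrt step_var ^ 4 = (sqrt step_var ^ 2) ^ 2" "sqrt step_var ^ 6 = (sqrt step_var ^ 2) ^ 3"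
      by (simp_all only: power_mult[symmetric]) simp_all
    then show "(\<lambda>x. (sqrt step_var * x)\<^sup>2) = (\<lambda>x. step_var * x\<^sup>2)" "(\<lambda>x. (sqrt step_var * x) ^ 4) = (\<lambda>x. step_var\<^sup>2 * x ^ 4)"
      "(\<lambda>x. (sqrt step_var * x) ^ 6) = (\<lambda>x. step_var ^ 3 * x ^ 6)"
      using step_var_nonneg by (simp_all add: power_mult_distrib)
  qed
  have gN_int: "integrable std_normal_distribution (\<lambda>x. ?g (sqrt step_var * x))"
    using g_bd by (intro N.integrable_const_bound[of _ "K\<^sup>2"]) auto
  note N_int = std_normal_square_moments
  have N_int': "integrable std_normal_distribution (\<lambda>x. (sqrt step_var * x) ^ 4)" "integrable std_normal_distribution (\<lambda>x. (sqrt step_var * x)\<^sup>2)"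
    "integrable std_normal_distribution (\<lambda>x. (sqrt step_var * x) ^ 6)"
    unfolding N_sq N_four N_six using N_int by simp_all
  have \<tau>_eq: "\<tau> = 3 * step_var\<^sup>2 - 2 * K * step_var + K\<^sup>2 - (LINT x|std_normal_distribution. ?g (sqrt step_var * x))"
  proof -
    have "\<tau> = (LINT x|std_normal_distribution. (sqrt step_var * x) ^ 4) - 2 * K * (LINT x|std_normal_distribution. (sqrt step_var * x)\<^sup>2)
        + K\<^sup>2 - (LINT x|std_normal_distribution. ?g (sqrt step_var * x))"
      unfolding \<tau>_def pos_part_square_eq using N_int' gN_int N.prob_space by simp
    then show ?thesis unfolding N_sq N_four using N_int by simp
  qed
  have "\<tau> \<le> (LINT x|std_normal_distribution. (sqrt step_var * x) ^ 6 / K)"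
    unfolding \<tau>_def
  proof (rule integral_mono)
    show "integrable std_normal_distribution (\<lambda>x. (max 0 ((sqrt step_var * x)\<^sup>2 - K))\<^sup>2)"
      unfolding pos_part_square_eq using N_int' gN_int by simp
    show "integrable std_normal_distribution (\<lambda>x. (sqrt step_var * x) ^ 6 / K)" using N_int' by simp
  qed (rule pos_part_square_le[OF K])
  also have "\<dots> = (LINT x|std_normal_distribution. (sqrt step_var * x) ^ 6) / K" by simp
  also have "\<dots> = 15 * step_var ^ 3 / K" unfolding N_six using N_int by simp
  finally have "\<tau> \<le> 15 * step_var ^ 3 / K" .
  moreover have "(\<lambda>n. expectation (\<lambda>\<omega>. (max 0 ((W n \<omega>)\<^sup>2 / n - K))\<^sup>2)) \<longlonglongrightarrow> \<tau>"
  proof -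
    have lim: "(\<lambda>n. (step_fourth / n + 3 * (1 - 1 / n) * step_var\<^sup>2) - 2 * K * step_var + K\<^sup>2 - expectation (\<lambda>\<omega>. ?g (W n \<omega> / sqrt n)))
        \<longlonglongrightarrow> (0 + 3 * (1 - 0) * step_var\<^sup>2) - 2 * K * step_var + K\<^sup>2 - (LINT x|std_normal_distribution. ?g (sqrt step_var * x))"
    proof -
      have "isCont ?g x" for x by (intro continuous_intros)
      then have "(\<lambda>n. expectation (\<lambda>\<omega>. ?g (W n \<omega> / sqrt n))) \<longlonglongrightarrow> (LINT x|std_normal_distribution. ?g (sqrt step_var * x))"
        by (rule clt_test_function) (rule g_bd)
      moreover have "(\<lambda>n. (step_fourth / real n + 3 * (1 - 1 / real n) * step_var\<^sup>2) - 2 * K * step_var + K\<^sup>2)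
          \<longlonglongrightarrow> (0 + 3 * (1 - 0) * step_var\<^sup>2) - 2 * K * step_var + K\<^sup>2"
        by (intro tendsto_add tendsto_diff tendsto_mult tendsto_const lim_const_over_n)
      ultimately show ?thesis by (intro tendsto_diff)
    qed
    have "expectation (\<lambda>\<omega>. (max 0 ((W n \<omega>)\<^sup>2 / n - K))\<^sup>2)
        = (step_fourth / n + 3 * (1 - 1 / n) * step_var\<^sup>2) - 2 * K * step_var + K\<^sup>2 - expectation (\<lambda>\<omega>. ?g (W n \<omega> / sqrt n))"
      if n: "n > 0" for n :: nat
    proof -
      have sq: "(W n \<omega>)\<^sup>2 / n = (W n \<omega> / sqrt n)\<^sup>2" and four: "(W n \<omega> / sqrt n) ^ 4 = (W n \<omega>) ^ 4 / n\<^sup>2" for \<omega>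
      proof -
        have "sqrt n ^ 4 = (sqrt n ^ 2) ^ 2" by (simp only: power_mult[symmetric]) simp
        then show "(W n \<omega>)\<^sup>2 / n = (W n \<omega> / sqrt n)\<^sup>2" "(W n \<omega> / sqrt n) ^ 4 = (W n \<omega>) ^ 4 / n\<^sup>2"
          by (simp_all add: power_divide)
      qed
      have gi: "integrable M (\<lambda>\<omega>. ?g (W n \<omega> / sqrt n))"
        using g_bd by (intro integrable_const_bound[of _ "K\<^sup>2"]) auto
      have "expectation (\<lambda>\<omega>. (max 0 ((W n \<omega>)\<^sup>2 / n - K))\<^sup>2)
        = expectation (\<lambda>\<omega>. (W n \<omega>) ^ 4 / n\<^sup>2 - 2 * K * ((W n \<omega>)\<^sup>2 / n) + K\<^sup>2 - ?g (W n \<omega> / sqrt n))"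
        unfolding sq pos_part_square_eq four ..
      also have "\<dots> = (real n * step_fourth + 3 * real n * (real n - 1) * step_var\<^sup>2) / n\<^sup>2 - 2 * K * (real n * step_var / n) + K\<^sup>2
          - expectation (\<lambda>\<omega>. ?g (W n \<omega> / sqrt n))"
        using gi W_fourth_integrable[of n] W_square_integrable[of n]
        by (simp add: W_fourth_expectation W_square_expectation prob_space)
      also have "(real n * step_fourth + 3 * real n * (real n - 1) * step_var\<^sup>2) / n\<^sup>2 = step_fourth / n + 3 * (1 - 1 / n) * step_var\<^sup>2"
        using n by (simp add: power2_eq_square field_simps)
      finally show ?thesis using n by simp
    qed
    then have "\<forall>\<^sub>F n in sequentially. (step_fourth / n + 3 * (1 - 1 / n) * step_var\<^sup>2) - 2 * K * step_var + K\<^sup>2 - expectation (\<lambda>\<omega>. ?g (W n \<omega> / sqrt n))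
        = expectation (\<lambda>\<omega>. (max 0 ((W n \<omega>)\<^sup>2 / n - K))\<^sup>2)"
      by (intro eventually_sequentiallyI[of 1]) simp
    from Lim_transform_eventually[OF lim this] show ?thesis by (simp add: \<tau>_eq)
  qed
  ultimately show ?thesis by blast
qed

text \<open>The function \<open>x \<mapsto> max 0 (x\<^sup>2 - c)\<close> is convex, hence Doob's inequality transfers the tail of \<open>W\<^sub>n\<close> to the tail of
the maximum.\<close>

lemma truncated_maximum:
  assumes c: "c \<ge> 0"
  shows "integrable M (\<lambda>\<omega>. (max 0 ((running_max (\<lambda>j. \<bar>W j \<omega>\<bar>) n)\<^sup>2 - c))\<^sup>2)"
    and "expectation (\<lambda>\<omega>. (max 0 ((running_max (\<lambda>j. \<bar>W j \<omega>\<bar>) n)\<^sup>2 - c))\<^sup>2)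
      \<le> 4 * expectation (\<lambda>\<omega>. (max 0 ((W n \<omega>)\<^sup>2 - c))\<^sup>2)"
proof -
  let ?\<phi> = "\<lambda>x :: real. max 0 (x\<^sup>2 - c)" and ?g = "\<lambda>x :: real. if x\<^sup>2 > c then 2 * x else 0"
  have sg: "?\<phi> a + ?g a * (b - a) \<le> ?\<phi> b" for a b
  proof (cases "a\<^sup>2 > c")
    case True
    have "a\<^sup>2 + 2 * a * (b - a) \<le> b\<^sup>2"
      using zero_le_power2[of "b - a"] by (simp add: power2_eq_square algebra_simps)
    with True show ?thesis by simp
  qed simp
  have gi: "integrable M (\<lambda>\<omega>. (?g (W j \<omega>))\<^sup>2)" for j
  proof (rule Bochner_Integration.integrable_bound)
    show "integrable M (\<lambda>\<omega>. 4 * (W j \<omega>)\<^sup>2)" using W_square_integrable by simp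
  qed (auto simp: power_mult_distrib)
  have D: "integrable M (\<lambda>\<omega>. (running_max (\<lambda>j. ?\<phi> (W j \<omega>)) n)\<^sup>2)"
    "expectation (\<lambda>\<omega>. (running_max (\<lambda>j. ?\<phi> (W j \<omega>)) n)\<^sup>2) \<le> 4 * expectation (\<lambda>\<omega>. (?\<phi> (W n \<omega>))\<^sup>2)"
    using doob_maximal[of ?\<phi> ?g n, OF _ _ _ sg truncated_square_integrable gi] by simp_all
  have le: "(?\<phi> (running_max (\<lambda>j. \<bar>W j \<omega>\<bar>) n))\<^sup>2 \<le> (running_max (\<lambda>j. ?\<phi> (W j \<omega>)) n)\<^sup>2" for \<omega>
  proof -
    obtain j where "j \<le> n" "running_max (\<lambda>j. \<bar>W j \<omega>\<bar>) n = \<bar>W j \<omega>\<bar>"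
      using running_max_attained by blast
    then show ?thesis using running_max_ge[of j n "\<lambda>j. ?\<phi> (W j \<omega>)"] by (intro power_mono) simp_all
  qed
  show i: "integrable M (\<lambda>\<omega>. (?\<phi> (running_max (\<lambda>j. \<bar>W j \<omega>\<bar>) n))\<^sup>2)"
    by (rule Bochner_Integration.integrable_bound[OF D(1)]) (use le in simp_all)
  show "expectation (\<lambda>\<omega>. (?\<phi> (running_max (\<lambda>j. \<bar>W j \<omega>\<bar>) n))\<^sup>2) \<le> 4 * expectation (\<lambda>\<omega>. (?\<phi> (W n \<omega>))\<^sup>2)"
    by (rule order_trans[OF integral_mono[OF i D(1) le] D(2)])
qed

end

section \<open>The limit of the variance\<close>

context centred_walk_4
begin

text \<open>Split the bound \<open>(2 / m) A\<^sup>2 / n\<close> on the remainder at the level \<open>A\<^sup>2 / n = K\<close>: below it the remainder is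
bounded and convergence in probability is enough, above it the tail of the maximum takes over.\<close>

lemma excess_square_bound:
  fixes K :: real and n :: nat
  assumes m: "m > 0" and n: "n > 0" and K: "K > 0"
  shows "integrable M (\<lambda>\<omega>. (excess m (\<lambda>j. W j \<omega>) n)\<^sup>2)"
    and "expectation (\<lambda>\<omega>. (excess m (\<lambda>j. W j \<omega>) n)\<^sup>2)
      \<le> 2 * (2 / m * K * max 1 (2 / m * K)) * expectation (\<lambda>\<omega>. min 1 \<bar>excess m (\<lambda>j. W j \<omega>) n\<bar>)
        + 32 / m\<^sup>2 * expectation (\<lambda>\<omega>. (max 0 ((W n \<omega>)\<^sup>2 / n - K))\<^sup>2)"
proof -
  define c where "c = 2 / m"
  have c: "c > 0" using m by (simp add: c_def)
  define L where "L = c * K * max 1 (c * K)"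
  let ?G = "\<lambda>\<omega>. excess m (\<lambda>j. W j \<omega>) n" and ?A = "\<lambda>\<omega>. (running_max (\<lambda>j. \<bar>W j \<omega>\<bar>) n)\<^sup>2"
  have pos_scale: "(max 0 (x / n - K))\<^sup>2 = (max 0 (x - K * n))\<^sup>2 / n\<^sup>2" for x
  proof -
    have "max 0 (x / n - K) = max 0 (x - K * n) / n"
      using n by (auto simp: max_def field_simps)
    then show ?thesis by (simp add: power_divide)
  qed
  have pt: "(?G \<omega>)\<^sup>2 \<le> 2 * L * min 1 \<bar>?G \<omega>\<bar> + 2 * c\<^sup>2 * ((max 0 (?A \<omega> - K * n))\<^sup>2 / n\<^sup>2)" for \<omega>
  proof -
    define g q where "g = \<bar>?G \<omega>\<bar>" and "q = max 0 (?A \<omega> / n - K)"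
    have "g \<le> c * (?A \<omega> / n)" unfolding g_def c_def
      using m n by (intro abs_excess_le_running_max) simp_all
    also have "\<dots> \<le> c * (K + q)" using c by (intro mult_left_mono) (auto simp: q_def)
    finally have "g \<le> c * K + c * q" by (simp add: distrib_left)
    moreover have "0 \<le> c * q" using c by (simp add: q_def)
    ultimately have g: "g \<le> min g (c * K) + c * q" by (auto simp: min_def)
    have "g\<^sup>2 \<le> (min g (c * K) + c * q)\<^sup>2" using g by (intro power_mono) (simp_all add: g_def)
    also have "\<dots> \<le> 2 * (min g (c * K))\<^sup>2 + 2 * (c * q)\<^sup>2"
      using zero_le_power2[of "min g (c * K) - c * q"] by (simp add: power2_eq_square algebra_simps)
    also have "(min g (c * K))\<^sup>2 \<le> (max 1 (c * K) * min 1 g) * (c * K)"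
      unfolding power2_eq_square
    proof (rule mult_mono)
      have "1 * g \<le> max 1 (c * K) * g" by (intro mult_right_mono) (auto simp: g_def)
      then show "min g (c * K) \<le> max 1 (c * K) * min 1 g"
        by (cases "g \<le> 1") (auto simp: min_def)
    qed (use c K in \<open>auto simp: g_def\<close>)
    finally have "g\<^sup>2 \<le> 2 * (max 1 (c * K) * min 1 g * (c * K)) + 2 * (c * q)\<^sup>2" by simp
    then show ?thesis
      by (simp add: g_def q_def L_def power_mult_distrib pos_scale mult_ac)
  qed
  have min_int: "integrable M (\<lambda>\<omega>. min 1 \<bar>?G \<omega>\<bar>)"
    by (intro integrable_const_bound[of _ 1]) auto
  have Kn: "K * n \<ge> 0" using K by simp
  note T = truncated_maximum[OF Kn, of n]
  have R_int: "integrable M (\<lambda>\<omega>. 2 * L * min 1 \<bar>?G \<omega>\<bar> + 2 * c\<^sup>2 * ((max 0 (?A \<omega> - K * n))\<^sup>2 / n\<^sup>2))"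
    using min_int T(1) by simp
  show G_int: "integrable M (\<lambda>\<omega>. (?G \<omega>)\<^sup>2)"
    by (rule Bochner_Integration.integrable_bound[OF R_int])
      (use pt in \<open>auto intro!: always_eventually order_trans[OF _ abs_ge_self]\<close>)
  have "expectation (\<lambda>\<omega>. (?G \<omega>)\<^sup>2)
      \<le> expectation (\<lambda>\<omega>. 2 * L * min 1 \<bar>?G \<omega>\<bar> + 2 * c\<^sup>2 * ((max 0 (?A \<omega> - K * n))\<^sup>2 / n\<^sup>2))"
    by (rule integral_mono[OF G_int R_int pt])
  also have "\<dots> = 2 * L * expectation (\<lambda>\<omega>. min 1 \<bar>?G \<omega>\<bar>)
      + 2 * c\<^sup>2 * (expectation (\<lambda>\<omega>. (max 0 (?A \<omega> - K * n))\<^sup>2) / n\<^sup>2)"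
    using min_int T(1) by simp
  also have "\<dots> \<le> 2 * L * expectation (\<lambda>\<omega>. min 1 \<bar>?G \<omega>\<bar>)
      + 2 * c\<^sup>2 * (4 * expectation (\<lambda>\<omega>. (max 0 ((W n \<omega>)\<^sup>2 - K * n))\<^sup>2) / n\<^sup>2)"
    by (intro add_left_mono mult_left_mono divide_right_mono T(2)) simp_all
  also have "\<dots> = 2 * L * expectation (\<lambda>\<omega>. min 1 \<bar>?G \<omega>\<bar>)
      + 32 / m\<^sup>2 * expectation (\<lambda>\<omega>. (max 0 ((W n \<omega>)\<^sup>2 / n - K))\<^sup>2)"
    by (simp add: pos_scale c_def power_divide)
  finally show "expectation (\<lambda>\<omega>. (?G \<omega>)\<^sup>2)
      \<le> 2 * (2 / m * K * max 1 (2 / m * K)) * expectation (\<lambda>\<omega>. min 1 \<bar>?G \<omega>\<bar>)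
        + 32 / m\<^sup>2 * expectation (\<lambda>\<omega>. (max 0 ((W n \<omega>)\<^sup>2 / n - K))\<^sup>2)"
    by (simp add: L_def c_def)
qed

text \<open>First \<open>n\<close> tends to infinity with the level \<open>K\<close> fixed, and then the remaining tail is made small by the choice
of \<open>K\<close>.\<close>

lemma excess_tendsto_in_mean_square:
  assumes m: "m > 0"
  shows "(\<lambda>n. expectation (\<lambda>\<omega>. (excess m (\<lambda>j. W j \<omega>) n)\<^sup>2)) \<longlonglongrightarrow> 0"
proof (rule order_tendstoI)
  fix e :: real assume "e < 0"
  moreover have "0 \<le> expectation (\<lambda>\<omega>. (excess m (\<lambda>j. W j \<omega>) n)\<^sup>2)" for n by simp
  ultimately show "\<forall>\<^sub>F n in sequentially. e < expectation (\<lambda>\<omega>. (excess m (\<lambda>j. W j \<omega>) n)\<^sup>2)"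
    by (intro always_eventually allI) (rule less_le_trans)
next
  fix e :: real assume e: "0 < e"
  \<comment> \<open>The limiting bound is \<open>(32 / m\<^sup>2) (15 v\<^sup>3 / K)\<close> for the step variance \<open>v\<close>, and \<open>480 = 32 * 15\<close>.\<close>
  define K where "K = 480 * step_var ^ 3 / m\<^sup>2 / e + 1"
  have K: "K > 0" using step_var_nonneg e by (simp add: K_def add_nonneg_pos)
  obtain \<tau> where \<tau>: "\<tau> \<le> 15 * step_var ^ 3 / K"
    and lim: "(\<lambda>n. expectation (\<lambda>\<omega>. (max 0 ((W n \<omega>)\<^sup>2 / n - K))\<^sup>2)) \<longlonglongrightarrow> \<tau>"
    using truncated_square_tendsto[OF K] by blast
  let ?R = "\<lambda>n. 2 * (2 / m * K * max 1 (2 / m * K)) * expectation (\<lambda>\<omega>. min 1 \<bar>excess m (\<lambda>j. W j \<omega>) n\<bar>)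
      + 32 / m\<^sup>2 * expectation (\<lambda>\<omega>. (max 0 ((W n \<omega>)\<^sup>2 / n - K))\<^sup>2)"
  have "?R \<longlonglongrightarrow> 2 * (2 / m * K * max 1 (2 / m * K)) * 0 + 32 / m\<^sup>2 * \<tau>"
    by (intro tendsto_add tendsto_mult tendsto_const lim excess_tendsto_in_probability[OF m])
  moreover have "2 * (2 / m * K * max 1 (2 / m * K)) * 0 + 32 / m\<^sup>2 * \<tau> < e"
  proof -
    have "32 / m\<^sup>2 * \<tau> \<le> 32 / m\<^sup>2 * (15 * step_var ^ 3 / K)" using \<tau> by (intro mult_left_mono) simp_all
    also have "\<dots> = (480 * step_var ^ 3 / m\<^sup>2) / K" by simp
    also have "480 * step_var ^ 3 / m\<^sup>2 = (K - 1) * e" using e by (simp add: K_def)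
    also have "(K - 1) * e / K < e" using K e by (simp add: field_simps)
    finally show ?thesis by simp
  qed
  ultimately have "\<forall>\<^sub>F n in sequentially. ?R n < e" by (rule order_tendstoD(2))
  then show "\<forall>\<^sub>F n in sequentially. expectation (\<lambda>\<omega>. (excess m (\<lambda>j. W j \<omega>) n)\<^sup>2) < e"
    using eventually_gt_at_top[of 0]
  proof eventually_elim
    case (elim n)
    then show ?case using excess_square_bound(2)[OF m elim(2) K] by linarith
  qed
qed

text \<open>Here \<open>a\<close> is the leading term \<open>W\<^sub>n\<^sup>2 / (2 m n)\<close> and \<open>G\<close> the remainder. The moments of \<open>a\<close> are
explicit, and \<open>G\<close> tends to zero in mean square, so its mean and its product with \<open>a\<close> vanish in the limit.\<close>

theorem graph_diam_variance_limit:
  assumes m: "m > 0"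
  shows "(\<lambda>n. variance (\<lambda>\<omega>. graph_diam m (\<lambda>j. W j \<omega>) n)) \<longlonglongrightarrow> step_var\<^sup>2 / (2 * m\<^sup>2)"
proof -
  define G where "G n \<omega> = excess m (\<lambda>j. W j \<omega>) n" for n \<omega>
  define a where "a n \<omega> = (W n \<omega>)\<^sup>2 / (2 * m * n)" for n \<omega>
  define g where "g n = expectation (\<lambda>\<omega>. (G n \<omega>)\<^sup>2)" for n
  define \<alpha> where "\<alpha> n = (step_fourth / n + 3 * (1 - 1 / n) * step_var\<^sup>2) / (4 * m\<^sup>2)" for n :: nat
  have [measurable]: "G n \<in> borel_measurable M" "a n \<in> borel_measurable M" for n
    unfolding G_def a_def by simp_all
  have g: "g \<longlonglongrightarrow> 0" unfolding g_def G_def by (rule excess_tendsto_in_mean_square[OF m])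
  have \<alpha>: "\<alpha> \<longlonglongrightarrow> (0 + 3 * (1 - 0) * step_var\<^sup>2) / (4 * m\<^sup>2)"
    unfolding \<alpha>_def using m
    by (intro tendsto_divide tendsto_add tendsto_mult tendsto_diff tendsto_const lim_const_over_n) simp
  have G_int: "integrable M (\<lambda>\<omega>. (G n \<omega>)\<^sup>2)" "integrable M (G n)" if "n > 0" for n
  proof -
    show sq: "integrable M (\<lambda>\<omega>. (G n \<omega>)\<^sup>2)"
      unfolding G_def by (rule excess_square_bound(1)[OF m that zero_less_one])
    show "integrable M (G n)" by (rule square_integrable_imp_integrable[OF _ sq]) simp
  qed
  have a_sq: "(a n \<omega>)\<^sup>2 = (W n \<omega>) ^ 4 / (4 * m\<^sup>2 * n\<^sup>2)" for n \<omega>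
    by (simp add: a_def power_divide power_mult_distrib power_mult[symmetric])
  have a_int: "integrable M (\<lambda>\<omega>. (a n \<omega>)\<^sup>2)" "integrable M (a n)" for n
  proof -
    show "integrable M (\<lambda>\<omega>. (a n \<omega>)\<^sup>2)" unfolding a_sq using W_fourth_integrable[of n] by simp
    show "integrable M (a n)" unfolding a_def[abs_def] using W_square_integrable[of n] by simp
  qed
  have aG_int: "integrable M (\<lambda>\<omega>. a n \<omega> * G n \<omega>)" if "n > 0" for n
    by (rule integrable_mult_of_squares) (simp_all add: a_int G_int[OF that])
  have Ea: "expectation (a n) = step_var / (2 * m)" if "n > 0" for n
    unfolding a_def[abs_def] using that W_square_integrable[of n] by (simp add: W_square_expectation)
  have Ea2: "expectation (\<lambda>\<omega>. (a n \<omega>)\<^sup>2) = \<alpha> n" if "n > 0" for n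
    unfolding a_sq \<alpha>_def using that m W_fourth_integrable[of n]
    by (simp add: W_fourth_expectation power2_eq_square field_simps)
  have EG: "(\<lambda>n. expectation (G n)) \<longlonglongrightarrow> 0"
  proof (rule Lim_null_comparison)
    show "\<forall>\<^sub>F n in sequentially. norm (expectation (G n)) \<le> sqrt (g n)"
      using eventually_gt_at_top[of 0]
    proof eventually_elim
      case (elim n)
      have "0 \<le> variance (G n)" by simp
      then have "(expectation (G n))\<^sup>2 \<le> g n"
        using variance_eq[OF G_int(2,1)[OF elim]] by (simp add: g_def)
      then show ?case using real_le_rsqrt[of "\<bar>expectation (G n)\<bar>" "g n"] by simp
    qed
    show "(\<lambda>n. sqrt (g n)) \<longlonglongrightarrow> 0" using tendsto_real_sqrt[OF g] by simp
  qed
  have EaG: "(\<lambda>n. expectation (\<lambda>\<omega>. a n \<omega> * G n \<omega>)) \<longlonglongrightarrow> 0"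
  proof (rule Lim_null_comparison)
    \<comment> \<open>The summand \<open>1 / n\<close> keeps the weight positive where \<open>g n\<close> vanishes.\<close>
    define \<delta> where "\<delta> n = sqrt (g n) + 1 / n" for n :: nat
    have \<delta>: "\<delta> \<longlonglongrightarrow> sqrt 0 + 0" unfolding \<delta>_def by (intro tendsto_add tendsto_real_sqrt g lim_const_over_n)
    have "(\<lambda>n. \<delta> n * \<alpha> n + sqrt (g n)) \<longlonglongrightarrow> (sqrt 0 + 0) * ((0 + 3 * (1 - 0) * step_var\<^sup>2) / (4 * m\<^sup>2)) + sqrt 0"
      by (intro tendsto_add tendsto_mult tendsto_real_sqrt g \<delta> \<alpha>)
    then show "(\<lambda>n. \<delta> n * \<alpha> n + sqrt (g n)) \<longlonglongrightarrow> 0" by simp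
    show "\<forall>\<^sub>F n in sequentially. norm (expectation (\<lambda>\<omega>. a n \<omega> * G n \<omega>)) \<le> \<delta> n * \<alpha> n + sqrt (g n)"
      using eventually_gt_at_top[of 0]
    proof eventually_elim
      case (elim n)
      have g0: "g n \<ge> 0" by (simp add: g_def)
      have \<delta>0: "\<delta> n > 0" using elim g0 by (simp add: \<delta>_def add_nonneg_pos)
      have pt: "\<bar>a n \<omega> * G n \<omega>\<bar> \<le> \<delta> n * (a n \<omega>)\<^sup>2 + (G n \<omega>)\<^sup>2 / \<delta> n" for \<omega>
      proof -
        define x y where "x = \<bar>a n \<omega>\<bar>" and "y = \<bar>G n \<omega>\<bar>"
        have "0 \<le> (\<delta> n * x - y)\<^sup>2 / \<delta> n" using \<delta>0 by simp
        also have "\<dots> = \<delta> n * x\<^sup>2 + y\<^sup>2 / \<delta> n - 2 * (x * y)"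
          using \<delta>0 by (simp add: power2_eq_square field_simps)
        finally have "2 * (x * y) \<le> \<delta> n * x\<^sup>2 + y\<^sup>2 / \<delta> n" by simp
        moreover have "0 \<le> x * y" by (simp add: x_def y_def)
        ultimately have "x * y \<le> \<delta> n * x\<^sup>2 + y\<^sup>2 / \<delta> n" by linarith
        then show ?thesis by (simp add: x_def y_def abs_mult)
      qed
      have "norm (expectation (\<lambda>\<omega>. a n \<omega> * G n \<omega>)) \<le> expectation (\<lambda>\<omega>. \<bar>a n \<omega> * G n \<omega>\<bar>)"
        using integral_abs_bound[of M "\<lambda>\<omega>. a n \<omega> * G n \<omega>"] by simp
      also have "\<dots> \<le> expectation (\<lambda>\<omega>. \<delta> n * (a n \<omega>)\<^sup>2 + (G n \<omega>)\<^sup>2 / \<delta> n)"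
        using aG_int[OF elim] a_int G_int[OF elim] by (intro integral_mono pt) simp_all
      also have "\<dots> = \<delta> n * \<alpha> n + g n / \<delta> n"
        using a_int G_int[OF elim] by (simp add: Ea2[OF elim] g_def)
      also have "g n / \<delta> n \<le> sqrt (g n)"
      proof -
        have "g n = sqrt (g n) * sqrt (g n)" using g0 by simp
        also have "\<dots> \<le> sqrt (g n) * \<delta> n" using g0 by (intro mult_left_mono) (simp_all add: \<delta>_def)
        finally show ?thesis using \<delta>0 by (simp add: divide_le_eq)
      qed
      finally show ?case by simp
    qed
  qed
  have lim: "(\<lambda>n. (\<alpha> n + 2 * expectation (\<lambda>\<omega>. a n \<omega> * G n \<omega>) + g n) - (step_var / (2 * m) + expectation (G n))\<^sup>2)
      \<longlonglongrightarrow> ((0 + 3 * (1 - 0) * step_var\<^sup>2) / (4 * m\<^sup>2) + 2 * 0 + 0) - (step_var / (2 * m) + 0)\<^sup>2"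
    by (intro tendsto_diff tendsto_add tendsto_mult tendsto_power tendsto_const \<alpha> g EG EaG)
  have "\<forall>\<^sub>F n in sequentially. (\<alpha> n + 2 * expectation (\<lambda>\<omega>. a n \<omega> * G n \<omega>) + g n) - (step_var / (2 * m) + expectation (G n))\<^sup>2
      = variance (\<lambda>\<omega>. graph_diam m (\<lambda>j. W j \<omega>) n)"
    using eventually_gt_at_top[of 0]
  proof eventually_elim
    case (elim n)
    note ints = a_int[of n] G_int[OF elim] aG_int[OF elim]
    have D: "graph_diam m (\<lambda>j. W j \<omega>) n = m * n + (a n \<omega> + G n \<omega>)" for \<omega>
      by (simp add: a_def G_def excess_def)
    have sq: "(a n \<omega> + G n \<omega>)\<^sup>2 = (a n \<omega>)\<^sup>2 + 2 * (a n \<omega> * G n \<omega>) + (G n \<omega>)\<^sup>2" for \<omega>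
      by (simp add: power2_sum)
    have "variance (\<lambda>\<omega>. graph_diam m (\<lambda>j. W j \<omega>) n) = variance (\<lambda>\<omega>. a n \<omega> + G n \<omega>)"
      unfolding D using ints by (simp add: prob_space)
    also have "\<dots> = expectation (\<lambda>\<omega>. (a n \<omega> + G n \<omega>)\<^sup>2) - (expectation (\<lambda>\<omega>. a n \<omega> + G n \<omega>))\<^sup>2"
      by (rule variance_eq) (use ints in \<open>simp_all add: sq\<close>)
    also have "expectation (\<lambda>\<omega>. (a n \<omega> + G n \<omega>)\<^sup>2) = \<alpha> n + 2 * expectation (\<lambda>\<omega>. a n \<omega> * G n \<omega>) + g n"
      unfolding sq using ints by (simp add: Ea2[OF elim] g_def)
    also have "expectation (\<lambda>\<omega>. a n \<omega> + G n \<omega>) = step_var / (2 * m) + expectation (G n)"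
      using ints by (simp add: Ea[OF elim])
    finally show ?case by simp
  qed
  from Lim_transform_eventually[OF lim this] show ?thesis
    using m by (simp add: power_divide power_mult_distrib field_simps)
qed

end

section \<open>The planar walk as a graph\<close>

lemma diameter_finite_family:
  fixes f :: "nat \<Rightarrow> 'b :: metric_space"
  shows "diameter (f ` {0..n}) = Max ((\<lambda>(i, j). dist (f i) (f j)) ` ({0..n} \<times> {0..n}))"
proof (rule antisym)
  let ?D = "(\<lambda>(i, j). dist (f i) (f j)) ` ({0..n} \<times> {0..n})"
  have bdd: "bounded (f ` {0..n})" by (simp add: finite_imp_bounded)
  have "f ` {0..n} \<noteq> {}" "compact (f ` {0..n})" by (auto simp: finite_imp_compact)
  from diameter_compact_attained[OF this(2,1)] obtain i j where "i \<le> n" "j \<le> n"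
    "dist (f i) (f j) = diameter (f ` {0..n})" by auto
  then show "diameter (f ` {0..n}) \<le> Max ?D"
    by (intro Max_ge) (auto intro!: image_eqI[of _ _ "(i, j)"])
  show "Max ?D \<le> diameter (f ` {0..n})"
    by (rule Max.boundedI) (auto intro!: diameter_bounded_bound[OF bdd])
qed

definition quarter_turn :: "real^2 \<Rightarrow> real^2" where
  "quarter_turn u = vector [- (u $ 2), u $ 1]"

lemma inner_quarter_turn_self: "u \<bullet> quarter_turn u = 0"
  by (simp add: quarter_turn_def inner_vec_def sum_2)

lemma norm_sq_quarter_turn:
  fixes u x :: "real^2"
  assumes "norm u = 1"
  shows "(norm x)\<^sup>2 = (x \<bullet> u)\<^sup>2 + (x \<bullet> quarter_turn u)\<^sup>2"
proof -
  have "(u $ 1)\<^sup>2 + (u $ 2)\<^sup>2 = 1"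
    using assms by (simp add: norm_eq_1 inner_vec_def sum_2 power2_eq_square)
  moreover have "(x \<bullet> u)\<^sup>2 + (x \<bullet> quarter_turn u)\<^sup>2 = ((x $ 1)\<^sup>2 + (x $ 2)\<^sup>2) * ((u $ 1)\<^sup>2 + (u $ 2)\<^sup>2)"
    by (simp add: quarter_turn_def inner_vec_def sum_2 power2_eq_square algebra_simps)
  ultimately show ?thesis
    unfolding power2_norm_eq_inner by (simp add: inner_vec_def sum_2 power2_eq_square)
qed

lemma walk_eq_sum: "walk X j \<omega> = (\<Sum>k<j. X (Suc k) \<omega>)"
  unfolding walk_def
  by (rule sum.reindex_bij_witness[of _ Suc "\<lambda>k. k - 1"]) auto

lemma walk_diam_eq_Max:
  "walk_diam X n \<omega> = Max ((\<lambda>(i, j). dist (walk X i \<omega>) (walk X j \<omega>)) ` ({0..n} \<times> {0..n}))"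
  unfolding walk_diam_def by (rule diameter_finite_family)

lemma walk_diam_measurable:
  assumes X: "\<And>k. k \<ge> 1 \<Longrightarrow> X k \<in> borel_measurable M"
  shows "walk_diam X n \<in> borel_measurable M"
proof -
  have [measurable]: "walk X j \<in> borel_measurable M" for j
    unfolding walk_def[abs_def] using X by (intro borel_measurable_sum) auto
  show ?thesis unfolding walk_diam_eq_Max[abs_def]
    by (intro borel_measurable_Max) (auto simp: case_prod_beta)
qed

text \<open>In the orthonormal frame of \<open>u\<close> and its quarter turn, the position at time \<open>j\<close> has first coordinate \<open>m j\<close>.\<close>

lemma walk_diam_eq_graph_diam:
  assumes u: "norm u = 1" and par: "\<And>k. k \<ge> 1 \<Longrightarrow> X k \<omega> \<bullet> u = m"
  shows "walk_diam X n \<omega> = graph_diam m (\<lambda>j. \<Sum>k<j. X (Suc k) \<omega> \<bullet> quarter_turn u) n"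
proof -
  have along: "walk X j \<omega> \<bullet> u = m * j" for j
    unfolding walk_eq_sum inner_sum_left using par by (simp add: mult.commute)
  have across: "walk X j \<omega> \<bullet> quarter_turn u = (\<Sum>k<j. X (Suc k) \<omega> \<bullet> quarter_turn u)" for j
    by (simp add: walk_eq_sum inner_sum_left)
  have "dist (walk X i \<omega>) (walk X j \<omega>) = sqrt ((m * (real j - real i))\<^sup>2
      + ((\<Sum>k<j. X (Suc k) \<omega> \<bullet> quarter_turn u) - (\<Sum>k<i. X (Suc k) \<omega> \<bullet> quarter_turn u))\<^sup>2)" for i j
  proof -
    have "(dist (walk X i \<omega>) (walk X j \<omega>))\<^sup>2 = (norm (walk X j \<omega> - walk X i \<omega>))\<^sup>2"
      by (simp add: dist_norm norm_minus_commute)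
    also have "\<dots> = (m * (real j - real i))\<^sup>2
      + ((\<Sum>k<j. X (Suc k) \<omega> \<bullet> quarter_turn u) - (\<Sum>k<i. X (Suc k) \<omega> \<bullet> quarter_turn u))\<^sup>2"
      unfolding norm_sq_quarter_turn[OF u] inner_diff_left along across by (simp add: right_diff_distrib)
    finally show ?thesis by (simp add: real_sqrt_unique)
  qed
  then show ?thesis unfolding walk_diam_eq_Max graph_diam_def by simp
qed

lemma (in finite_measure) integrable_power_of_moment:
  fixes Z :: "'a \<Rightarrow> 'b :: {banach, second_countable_topology}"
  assumes [measurable]: "Z \<in> borel_measurable M" and int: "integrable M (\<lambda>\<omega>. norm (Z \<omega>) powr p)" and k: "real k \<le> p"
  shows "integrable M (\<lambda>\<omega>. norm (Z \<omega>) ^ k)"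
proof (rule Bochner_Integration.integrable_bound)
  show "integrable M (\<lambda>\<omega>. 1 + norm (Z \<omega>) powr p)" using int by simp
  have "x ^ k \<le> 1 + x powr p" if "x \<ge> 0" for x :: real
  proof (cases "x \<le> 1")
    case True
    then have "x ^ k \<le> 1" using that by (simp add: power_le_one)
    then show ?thesis by (simp add: add_increasing2)
  next
    case False
    then have "x ^ k = x powr k" by (simp add: powr_realpow)
    also have "\<dots> \<le> x powr p" using False k by (intro powr_mono) auto
    finally show ?thesis by simp
  qed
  then show "AE \<omega> in M. norm (norm (Z \<omega>) ^ k) \<le> norm (1 + norm (Z \<omega>) powr p)"
    by (intro always_eventually allI) simp
qed simp

text \<open>The vanishing variance along the mean forces the component of each step along the mean direction to equal
the norm \<open>m\<close> of the mean almost surely; the perpendicular components form a centred walk on the line, to which the results on graph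
diameters apply.\<close>

theorem theorem1p11:
  fixes M :: "'a measure" and N :: "'b measure"
    and Z :: "'a \<Rightarrow> real^2" and X :: "nat \<Rightarrow> 'a \<Rightarrow> real^2"
    and \<zeta> :: "'b \<Rightarrow> real"
  assumes "prob_space M"
    and Z_meas: "Z \<in> borel_measurable M"
    and X_indep: "prob_space.indep_vars M (\<lambda>_. borel) X {1..}"
    and X_distr: "\<And>k. k \<ge> 1 \<Longrightarrow> distr M borel (X k) = distr M borel Z"
    and moment: "\<exists>p>2. integrable M (\<lambda>\<omega>. norm (Z \<omega>) powr p)"
    and mean_nz: "mean_vec M Z \<noteq> 0"
    and var_par_0: "var_par M Z = 0"
    and "prob_space N"
    and \<zeta>_normal: "distributed N lborel \<zeta> std_normal_density"
  shows "weak_conv_m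
           (\<lambda>n. distr M borel (\<lambda>\<omega>. walk_diam X n \<omega> - norm (mean_vec M Z) * real n))
           (distr N borel (\<lambda>\<omega>. var_perp M Z * (\<zeta> \<omega>)\<^sup>2 / (2 * norm (mean_vec M Z))))
       \<and> ((\<exists>p>4. integrable M (\<lambda>\<omega>. norm (Z \<omega>) powr p)) \<longrightarrow>
           (\<lambda>n. prob_space.variance M (walk_diam X n))
             \<longlonglongrightarrow> (var_perp M Z)\<^sup>2 / (2 * (norm (mean_vec M Z))\<^sup>2))"
proof -
  interpret prob_space M by fact
  note [measurable] = Z_meas
  define \<mu> u e m where "\<mu> = mean_vec M Z" and "u = mean_dir M Z" and "e = quarter_turn (mean_dir M Z)"
    and "m = norm (mean_vec M Z)"
  define Y where "Y k \<omega> = X (Suc k) \<omega> \<bullet> e" for k \<omega>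
  have m: "m > 0" using mean_nz by (simp add: m_def)
  have u1: "norm u = 1" using mean_nz by (simp add: u_def mean_dir_def)
  have \<mu>u: "\<mu> = m *\<^sub>R u" using mean_nz by (simp add: \<mu>_def m_def u_def mean_dir_def)
  have e_eq: "e = quarter_turn u" by (simp add: e_def u_def)
  have \<mu>_along: "\<mu> \<bullet> u = m" using u1 by (simp add: \<mu>u norm_eq_1)
  have \<mu>_across: "\<mu> \<bullet> e = 0" by (simp add: \<mu>u e_eq inner_quarter_turn_self)
  have pythagoras: "(norm x)\<^sup>2 = (x \<bullet> u)\<^sup>2 + (x \<bullet> e)\<^sup>2" for x
    unfolding e_eq by (rule norm_sq_quarter_turn[OF u1])
  have across_le: "\<bar>x \<bullet> e\<bar> \<le> norm x" for x
  proof -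
    have "(x \<bullet> e)\<^sup>2 \<le> (norm x)\<^sup>2" using pythagoras[of x] by simp
    then show ?thesis using abs_le_square_iff[of "x \<bullet> e" "norm x"] by simp
  qed
  have X_meas [measurable]: "X k \<in> borel_measurable M" if "k \<ge> 1" for k
    using X_indep that by (simp add: indep_vars_def)
  have Y_meas [measurable]: "Y k \<in> borel_measurable M" for k
    unfolding Y_def[abs_def] by (intro borel_measurable_inner X_meas) simp_all

  obtain p where "p > 2" "integrable M (\<lambda>\<omega>. norm (Z \<omega>) powr p)" using moment by blast
  then have Z_sq_int: "integrable M (\<lambda>\<omega>. (norm (Z \<omega>))\<^sup>2)"
    and "integrable M (\<lambda>\<omega>. norm (Z \<omega>))"
    using integrable_power_of_moment[OF Z_meas, of p 2] integrable_power_of_moment[OF Z_meas, of p 1] by simp_all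
  then have Z_int: "integrable M Z" using integrable_norm_cancel[of M Z] Z_meas by blast
  have across_int: "integrable M (\<lambda>\<omega>. (Z \<omega> \<bullet> e)\<^sup>2)"
    by (rule Bochner_Integration.integrable_bound[OF Z_sq_int])
      (use across_le in \<open>auto intro!: always_eventually power_mono simp: abs_le_square_iff[symmetric]\<close>)
  have along_int: "integrable M (\<lambda>\<omega>. ((Z \<omega> - \<mu>) \<bullet> u)\<^sup>2)"
  proof -
    have eq: "((Z \<omega> - \<mu>) \<bullet> u)\<^sup>2 = (norm (Z \<omega>))\<^sup>2 - (Z \<omega> \<bullet> e)\<^sup>2 - 2 * m * (Z \<omega> \<bullet> u) + m\<^sup>2" for \<omega>
      unfolding pythagoras inner_diff_left \<mu>_along by (simp add: power2_diff)
    show ?thesis unfolding eq using Z_sq_int across_int Z_int by simp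
  qed
  have "AE \<omega> in M. ((Z \<omega> - \<mu>) \<bullet> u)\<^sup>2 = 0"
    using var_par_0 along_int unfolding var_par_def \<mu>_def[symmetric] u_def[symmetric]
    by (subst integral_nonneg_eq_0_iff_AE[symmetric]) auto
  then have Z_along: "AE \<omega> in M. Z \<omega> \<bullet> u = m" by (simp add: inner_diff_left \<mu>_along)

  have X_along: "AE \<omega> in M. \<forall>k\<ge>1. X k \<omega> \<bullet> u = m"
  proof -
    have "AE \<omega> in M. X k \<omega> \<bullet> u = m" if k: "k \<ge> 1" for k
    proof -
      have "AE x in distr M borel Z. x \<bullet> u = m"
        by (subst AE_distr_iff) (use Z_along in auto)
      then have "AE x in distr M borel (X k). x \<bullet> u = m" by (simp only: X_distr[OF k])
      then show ?thesis using X_meas[OF k] by (subst (asm) AE_distr_iff) auto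
    qed
    then show ?thesis by (subst AE_all_countable) (auto intro: AE_impI)
  qed

  have step_distr: "distr M borel (Y k) = distr M borel (\<lambda>\<omega>. Z \<omega> \<bullet> e)" for k
  proof -
    have [measurable]: "X (Suc k) \<in> borel_measurable M" by simp
    have "distr M borel (Y k) = distr (distr M borel (X (Suc k))) borel (\<lambda>x. x \<bullet> e)"
      unfolding Y_def[abs_def] by (subst distr_distr) (auto simp: comp_def)
    also have "\<dots> = distr M borel (\<lambda>\<omega>. Z \<omega> \<bullet> e)"
      unfolding X_distr[of "Suc k", simplified] by (subst distr_distr) (auto simp: comp_def)
    finally show ?thesis .
  qed
  have step_int: "integrable M (\<lambda>\<omega>. f (Y 0 \<omega>)) \<longleftrightarrow> integrable M (\<lambda>\<omega>. f (Z \<omega> \<bullet> e))"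
    and step_expectation: "expectation (\<lambda>\<omega>. f (Y 0 \<omega>)) = expectation (\<lambda>\<omega>. f (Z \<omega> \<bullet> e))"
    if [measurable]: "f \<in> borel_measurable borel" for f :: "real \<Rightarrow> real"
    using step_distr[of 0] integrable_distr_eq[of "Y 0" M borel f] integrable_distr_eq[of "\<lambda>\<omega>. Z \<omega> \<bullet> e" M borel f]
      integral_distr[of "Y 0" M borel f] integral_distr[of "\<lambda>\<omega>. Z \<omega> \<bullet> e" M borel f] by simp_all
  interpret walk: centred_walk M Y
  proof
    have "indep_vars (\<lambda>k. Pi\<^sub>M {Suc k} (\<lambda>_. borel)) (\<lambda>k \<omega>. \<lambda>i\<in>{Suc k}. X i \<omega>) UNIV"
      using X_indep by (rule indep_vars_restrict) (auto simp: disjoint_family_on_def)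
    then have "indep_vars (\<lambda>_. borel) (\<lambda>k \<omega>. (\<lambda>i\<in>{Suc k}. X i \<omega>) (Suc k) \<bullet> e) UNIV"
      by (rule indep_vars_compose2) (intro borel_measurable_inner measurable_component_singleton, simp_all)
    then show "indep_vars (\<lambda>_. borel) Y UNIV" unfolding Y_def[abs_def] by simp
    show "distr M borel (Y k) = distr M borel (Y 0)" for k by (simp add: step_distr)
    show "integrable M (\<lambda>\<omega>. (Y 0 \<omega>)\<^sup>2)" using step_int[of "\<lambda>y. y\<^sup>2"] across_int by simp
    have "expectation (\<lambda>\<omega>. Z \<omega> \<bullet> e) = \<mu> \<bullet> e" using Z_int by (simp add: \<mu>_def mean_vec_def)
    then show "expectation (Y 0) = 0" using step_expectation[of "\<lambda>y. y"] \<mu>_across by simp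
  qed
  have step_var: "walk.step_var = var_perp M Z"
  proof -
    have eq: "(norm (Z \<omega> - \<mu>))\<^sup>2 = ((Z \<omega> - \<mu>) \<bullet> u)\<^sup>2 + (Z \<omega> \<bullet> e)\<^sup>2" for \<omega>
      unfolding pythagoras by (simp add: inner_diff_left \<mu>_across)
    have "var_total M Z = var_par M Z + expectation (\<lambda>\<omega>. (Z \<omega> \<bullet> e)\<^sup>2)"
      unfolding var_total_def var_par_def \<mu>_def[symmetric] u_def[symmetric] eq using along_int across_int by simp
    then show ?thesis unfolding walk.step_var_def var_perp_def using step_expectation[of "\<lambda>y. y\<^sup>2"] by simp
  qed
  have diam: "AE \<omega> in M. walk_diam X n \<omega> = graph_diam m (\<lambda>j. walk.W j \<omega>) n" for n
    using X_along
  proof eventually_elim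
    case (elim \<omega>)
    then show ?case unfolding walk.W_def Y_def e_eq by (intro walk_diam_eq_graph_diam[OF u1]) simp
  qed
  have D_meas [measurable]: "walk_diam X n \<in> borel_measurable M" for n
    by (rule walk_diam_measurable[OF X_meas])
  have G_meas [measurable]: "(\<lambda>\<omega>. graph_diam m (\<lambda>j. walk.W j \<omega>) n) \<in> borel_measurable M" for n
    by (rule graph_diam_measurable) simp

  have "distr M borel (\<lambda>\<omega>. walk_diam X n \<omega> - m * real n)
      = distr M borel (\<lambda>\<omega>. graph_diam m (\<lambda>j. walk.W j \<omega>) n - m * real n)" for n
    using diam[of n] by (intro distr_cong_AE) auto
  moreover have "distr N borel (\<lambda>\<omega>. walk.step_var * (\<zeta> \<omega>)\<^sup>2 / (2 * m))
      = distr std_normal_distribution borel (\<lambda>x. walk.step_var * x\<^sup>2 / (2 * m))"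
  proof -
    have [measurable]: "\<zeta> \<in> borel_measurable N" using distributed_measurable[OF \<zeta>_normal] by simp
    have "distr std_normal_distribution borel (\<lambda>x. walk.step_var * x\<^sup>2 / (2 * m))
        = distr (distr N lborel \<zeta>) borel (\<lambda>x. walk.step_var * x\<^sup>2 / (2 * m))"
      using distributed_distr_eq_density[OF \<zeta>_normal] by simp
    also have "\<dots> = distr N borel (\<lambda>\<omega>. walk.step_var * (\<zeta> \<omega>)\<^sup>2 / (2 * m))"
      by (subst distr_distr) (auto simp: comp_def)
    finally show ?thesis by simp
  qed
  ultimately have weak: "weak_conv_m (\<lambda>n. distr M borel (\<lambda>\<omega>. walk_diam X n \<omega> - m * real n))
      (distr N borel (\<lambda>\<omega>. walk.step_var * (\<zeta> \<omega>)\<^sup>2 / (2 * m)))"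
    using walk.graph_diam_weak_limit[OF m] by simp

  have "(\<lambda>n. variance (walk_diam X n)) \<longlonglongrightarrow> walk.step_var\<^sup>2 / (2 * m\<^sup>2)"
    if fourth: "\<exists>p>4. integrable M (\<lambda>\<omega>. norm (Z \<omega>) powr p)"
  proof -
    obtain p where "p > 4" "integrable M (\<lambda>\<omega>. norm (Z \<omega>) powr p)" using fourth by blast
    then have Z4: "integrable M (\<lambda>\<omega>. norm (Z \<omega>) ^ 4)"
      using integrable_power_of_moment[OF Z_meas, of p 4] by simp
    interpret walk4: centred_walk_4 M Y
    proof
      have "(x \<bullet> e) ^ 4 \<le> norm x ^ 4" for x
        using power_mono[OF across_le[of x] abs_ge_zero, of 4] by (simp add: power_even_abs)
      then have "integrable M (\<lambda>\<omega>. (Z \<omega> \<bullet> e) ^ 4)"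
        by (intro Bochner_Integration.integrable_bound[OF Z4]) auto
      then show "integrable M (\<lambda>\<omega>. (Y 0 \<omega>) ^ 4)" using step_int[of "\<lambda>y. y ^ 4"] by simp
    qed
    have E: "expectation (walk_diam X n) = expectation (\<lambda>\<omega>. graph_diam m (\<lambda>j. walk.W j \<omega>) n)" for n
      using diam[of n] by (intro integral_cong_AE) auto
    have "variance (walk_diam X n) = variance (\<lambda>\<omega>. graph_diam m (\<lambda>j. walk.W j \<omega>) n)" for n
      unfolding E using diam[of n] by (intro integral_cong_AE) auto
    then show ?thesis using walk4.graph_diam_variance_limit[OF m] by simp
  qed
  with weak show ?thesis by (simp add: step_var m_def)
qed

end
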